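(* Let $\mathcal{H}$ be a separable Hilbert space, $U,V\in\mathcal{B}(\mathcal{H})$, and let $\Phi=\{\phi_i\}_{i\in I}$ and $\Psi=\{\psi_i\}_{i\in I}$ be frames for $\mathcal{H}$ with lower frame bounds $A_\Phi,A_\Psi$ and upper frame bounds $B_\Phi,B_\Psi$, such that $\mathbf{G}_{U,\Phi,\Psi}$ is invertible on $\ell^2(I)$ (so that $U$ is invertible). Let $\Xi=\{\xi_i\}_{i\in I}$ and $\Theta=\{\theta_i\}_{i\in I}$ be Bessel sequences in $\mathcal{H}$ with Bessel bounds $B_\Xi,B_\Theta$, and let $\lambda_1,\lambda_2,\lambda_3,\lambda_4\ge 0$ and $\mu$ be real numbers such that $$\Big\|\sum_{i\in I}c_i(\psi_i-\theta_i)\Big\|+\Big\|\sum_{i\in I}c_i(\phi_i-\xi_i)\Big\|\le\lambda_1\Big\|\sum_{i\in I}c_i\psi_i\Big\|+\lambda_2\Big\|\sum_{i\in I}c_i\phi_i\Big\|+\lambda_3\Big\|\sum_{i\in I}c_i\xi_i\Big\|+\lambda_4\Big\|\sum_{i\in I}c_i\theta_i\Big\|$$ for all $c=\{c_i\}_{i\in I}\in\ell^2(I)$, and $$\|U-V\|<\mu,\qquad \mu+2\|U\|\lambda<\frac{\sqrt{A_\Psi A_\Phi}}{\|U^{-1}\|\,B},\qquad \lambda\Big(1+3\sqrt{\tfrac{B}{A}}\Big)<1,$$ where $B=\max\{B_\Phi,B_\Psi,B_\Xi,B_\Theta\}$, $A=\min\{A_\Phi,A_\Psi\}$ and $\lambda=\lambda_1+\lambda_2+\lambda_3+\lambda_4$.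 Then $\mathbf{G}_{V,\Xi,\Theta}$ is invertible, and $\Xi$ and $\Theta$ are Riesz bases for $\mathcal{H}$.
   Context: All Hilbert spaces are separable, $I$ is a countable index set, $\ell^2=\ell^2(I)$, $\mathcal{B}(\mathcal{H})$ is the set of bounded linear operators on $\mathcal{H}$. A sequence $\Phi=\{\phi_i\}_{i\in I}$ in $\mathcal{H}$ is a Bessel sequence with Bessel bound $B_\Phi>0$ if $\sum_{i}|\langle f,\phi_i\rangle|^2\le B_\Phi\|f\|^2$ for all $f\in\mathcal{H}$, and a frame with lower and upper bounds $A_\Phi,B_\Phi>0$ if moreover $A_\Phi\|f\|^2\le\sum_i|\langle f,\phi_i\rangle|^2$ for all $f$. The synthesis operator of a Bessel sequence is $T_\Phi:\ell^2\to\mathcal{H}$, $T_\Phi\{c_i\}=\sum_ic_i\phi_i$. A Riesz basis for $\mathcal{H}$ is the image of an orthonormal basis under a bounded bijective operator. For Bessel sequences $\Phi,\Psi$ in $\mathcal{H}$ and $U\in\mathcal{B}(\mathcal{H})$, the $U$-cross Gram matrix is $(\mathbf{G}_{U,\Phi,\Psi})_{i,j}=\langle U\psi_j,\phi_i\rangle$, equivalently the bounded operator $T_\Phi^*UT_\Psi$ on $\ell^2$. When $\Phi,\Psi$ are frames and $\mathbf{G}_{U,\Phi,\Psi}$ is invertible, $U$ is invertible. *)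

theory Defs
  imports "HOL-Analysis.Analysis"
begin

section \<open>Complex Hilbert spaces\<close>

text \<open>
  The distribution only has real inner product spaces. The class below adds complex scalars and a
  complex inner product to a real normed space. The inner product is linear in the first argument.
  Nonnegativity and definiteness of \<open>cinner x x\<close> follow from the last axiom and the norm axioms.
\<close>

class complex_inner = real_normed_vector +
  fixes scaleC :: "complex \<Rightarrow> 'a \<Rightarrow> 'a" (infixr "*\<^sub>C" 75)
    and cinner :: "'a \<Rightarrow> 'a \<Rightarrow> complex"
  assumes scaleC_add_right: "a *\<^sub>C (x + y) = a *\<^sub>C x + a *\<^sub>C y"
    and scaleC_add_left: "(a + b) *\<^sub>C x = a *\<^sub>C x + b *\<^sub>C x"
    and scaleC_scaleC: "a *\<^sub>C b *\<^sub>C x = (a * b) *\<^sub>C x"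
    and scaleC_of_real: "complex_of_real r *\<^sub>C x = r *\<^sub>R x"
    and cinner_commute: "cinner x y = cnj (cinner y x)"
    and cinner_add_left: "cinner (x + y) z = cinner x z + cinner y z"
    and cinner_scaleC_left: "cinner (a *\<^sub>C x) y = a * cinner x y"
    and norm_eq_sqrt_cinner: "norm x = sqrt (Re (cinner x x))"

class chilbert_space = complex_inner + complete_space

global_interpretation complex_vector:
  vector_space "scaleC :: complex \<Rightarrow> 'a \<Rightarrow> 'a::complex_inner"
  defines cspan = complex_vector.span
proof
  show "1 *\<^sub>C x = x" for x :: 'a
    using scaleC_of_real[of 1 x] by simp
qed (simp_all add: scaleC_add_right scaleC_add_left scaleC_scaleC)

definition bounded_clinear :: "('a::complex_inner \<Rightarrow> 'b::complex_inner) \<Rightarrow> bool" where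
  "bounded_clinear T \<longleftrightarrow> bounded_linear T \<and> (\<forall>a x. T (a *\<^sub>C x) = a *\<^sub>C T x)"

definition invertible_operator :: "('a::complex_inner \<Rightarrow> 'b::complex_inner) \<Rightarrow> bool" where
  "invertible_operator T \<longleftrightarrow>
     bounded_clinear T \<and> (\<exists>S. bounded_clinear S \<and> S \<circ> T = id \<and> T \<circ> S = id)"

section \<open>The sequence space\<close>

typedef 'i ell2 = "{c :: 'i \<Rightarrow> complex. (\<lambda>i. (cmod (c i))\<^sup>2) summable_on UNIV}"
  morphisms ell2_nth Abs_ell2
  by (rule exI[of _ "\<lambda>_. 0"]) simp

setup_lifting type_definition_ell2

lemma square_summableI:
  fixes c :: "'i \<Rightarrow> complex"
  assumes "\<And>F. finite F \<Longrightarrow> L2_set (\<lambda>i. cmod (c i)) F \<le> K"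
  shows "(\<lambda>i. (cmod (c i))\<^sup>2) summable_on UNIV"
    and "sqrt (\<Sum>\<^sub>\<infinity>i. (cmod (c i))\<^sup>2) \<le> K"
proof -
  have K: "0 \<le> K"
    using assms[of "{}"] by simp
  have bd: "(\<Sum>i\<in>F. (cmod (c i))\<^sup>2) \<le> K\<^sup>2" if "finite F" for F
    using assms[OF that] K unfolding L2_set_def by (metis real_le_lsqrt real_sqrt_le_iff real_sqrt_abs abs_of_nonneg)
  show s: "(\<lambda>i. (cmod (c i))\<^sup>2) summable_on UNIV"
    by (rule nonneg_bdd_above_summable_on) (auto intro!: bdd_aboveI2[where M = "K\<^sup>2"] bd)
  have "(\<Sum>\<^sub>\<infinity>i. (cmod (c i))\<^sup>2) \<le> K\<^sup>2"
    by (rule has_sum_le_finite_sums[OF has_sum_infsum[OF s]]) (rule bd)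
  thus "sqrt (\<Sum>\<^sub>\<infinity>i. (cmod (c i))\<^sup>2) \<le> K"
    using K real_le_lsqrt by auto
qed

lemma L2_set_le_square_summable:
  fixes c :: "'i \<Rightarrow> complex"
  assumes "(\<lambda>i. (cmod (c i))\<^sup>2) summable_on UNIV" "finite F"
  shows "L2_set (\<lambda>i. cmod (c i)) F \<le> sqrt (\<Sum>\<^sub>\<infinity>i. (cmod (c i))\<^sup>2)"
  unfolding L2_set_def real_sqrt_le_iff
  by (rule finite_sum_le_infsum) (use assms in auto)

lemma L2_set_cmod_add:
  "L2_set (\<lambda>i. cmod (c i + d i)) F \<le> L2_set (\<lambda>i. cmod (c i)) F + L2_set (\<lambda>i. cmod (d i)) F"
  by (rule order_trans[OF L2_set_mono L2_set_triangle_ineq]) (auto intro: norm_triangle_ineq)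

lemma square_summable_add:
  fixes c d :: "'i \<Rightarrow> complex"
  assumes "(\<lambda>i. (cmod (c i))\<^sup>2) summable_on UNIV" "(\<lambda>i. (cmod (d i))\<^sup>2) summable_on UNIV"
  shows "(\<lambda>i. (cmod (c i + d i))\<^sup>2) summable_on UNIV"
    and "sqrt (\<Sum>\<^sub>\<infinity>i. (cmod (c i + d i))\<^sup>2) \<le>
           sqrt (\<Sum>\<^sub>\<infinity>i. (cmod (c i))\<^sup>2) + sqrt (\<Sum>\<^sub>\<infinity>i. (cmod (d i))\<^sup>2)"
proof -
  have "L2_set (\<lambda>i. cmod (c i + d i)) F \<le>
          sqrt (\<Sum>\<^sub>\<infinity>i. (cmod (c i))\<^sup>2) + sqrt (\<Sum>\<^sub>\<infinity>i. (cmod (d i))\<^sup>2)" if "finite F" for F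
    using L2_set_cmod_add[of c d F] L2_set_le_square_summable[OF assms(1) that]
      L2_set_le_square_summable[OF assms(2) that] by linarith
  from square_summableI[of "\<lambda>i. c i + d i", OF this]
  show "(\<lambda>i. (cmod (c i + d i))\<^sup>2) summable_on UNIV"
    and "sqrt (\<Sum>\<^sub>\<infinity>i. (cmod (c i + d i))\<^sup>2) \<le>
           sqrt (\<Sum>\<^sub>\<infinity>i. (cmod (c i))\<^sup>2) + sqrt (\<Sum>\<^sub>\<infinity>i. (cmod (d i))\<^sup>2)"
    by auto
qed

lemma square_summable_scale:
  fixes c :: "'i \<Rightarrow> complex"
  assumes "(\<lambda>i. (cmod (c i))\<^sup>2) summable_on UNIV"
  shows "(\<lambda>i. (cmod (a * c i))\<^sup>2) summable_on UNIV"
  using summable_on_cmult_right[OF assms, of "(cmod a)\<^sup>2"]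
  by (simp add: norm_mult power_mult_distrib)

lemma square_summable_uminus:
  fixes c :: "'i \<Rightarrow> complex"
  assumes "(\<lambda>i. (cmod (c i))\<^sup>2) summable_on UNIV"
  shows "(\<lambda>i. (cmod (- c i))\<^sup>2) summable_on UNIV"
  using assms by simp

lemma ell2_summable: "(\<lambda>i. (cmod (ell2_nth c i))\<^sup>2) summable_on UNIV"
  using ell2_nth[of c] by simp

lemma ell2_product_summable: "(\<lambda>i. ell2_nth c i * cnj (ell2_nth d i)) summable_on UNIV"
proof (rule abs_summable_summable, rule abs_summable_product)
  show "(\<lambda>i. norm (ell2_nth c i * ell2_nth c i)) summable_on UNIV"
    using ell2_summable[of c] by (simp add: norm_mult power2_eq_square)
  show "(\<lambda>i. norm (cnj (ell2_nth d i) * cnj (ell2_nth d i))) summable_on UNIV"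
    using ell2_summable[of d] by (simp add: norm_mult power2_eq_square)
qed

instantiation ell2 :: (type) complex_inner
begin

lift_definition zero_ell2 :: "'a ell2" is "\<lambda>_. 0"
  by simp

lift_definition plus_ell2 :: "'a ell2 \<Rightarrow> 'a ell2 \<Rightarrow> 'a ell2" is "\<lambda>c d i. c i + d i"
  by (rule square_summable_add)

lift_definition uminus_ell2 :: "'a ell2 \<Rightarrow> 'a ell2" is "\<lambda>c i. - c i"
  by (rule square_summable_uminus)

lift_definition minus_ell2 :: "'a ell2 \<Rightarrow> 'a ell2 \<Rightarrow> 'a ell2" is "\<lambda>c d i. c i - d i"
  using square_summable_add(1) square_summable_uminus by fastforce

lift_definition scaleR_ell2 :: "real \<Rightarrow> 'a ell2 \<Rightarrow> 'a ell2" is "\<lambda>r c i. of_real r * c i"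
  by (rule square_summable_scale)

lift_definition scaleC_ell2 :: "complex \<Rightarrow> 'a ell2 \<Rightarrow> 'a ell2" is "\<lambda>a c i. a * c i"
  by (rule square_summable_scale)

lift_definition cinner_ell2 :: "'a ell2 \<Rightarrow> 'a ell2 \<Rightarrow> complex" is
  "\<lambda>c d. \<Sum>\<^sub>\<infinity>i. c i * cnj (d i)" .

lift_definition norm_ell2 :: "'a ell2 \<Rightarrow> real" is
  "\<lambda>c. sqrt (\<Sum>\<^sub>\<infinity>i. (cmod (c i))\<^sup>2)" .

definition dist_ell2 :: "'a ell2 \<Rightarrow> 'a ell2 \<Rightarrow> real" where
  "dist_ell2 c d = norm (c - d)"

definition sgn_ell2 :: "'a ell2 \<Rightarrow> 'a ell2" where
  "sgn_ell2 c = inverse (norm c) *\<^sub>R c"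

definition uniformity_ell2 :: "('a ell2 \<times> 'a ell2) filter" where
  "uniformity_ell2 = (INF e\<in>{0 <..}. principal {(c, d). dist c d < e})"

definition open_ell2 :: "'a ell2 set \<Rightarrow> bool" where
  "open_ell2 U \<longleftrightarrow> (\<forall>x\<in>U. eventually (\<lambda>(x', y). x' = x \<longrightarrow> y \<in> U) uniformity)"

instance
proof
  fix a b :: complex and r s :: real and x y z :: "'a ell2" and U :: "'a ell2 set"
  show "x + y + z = x + (y + z)" "x + y = y + x" "0 + x = x" "- x + x = 0" "x - y = x + - y"
    by (transfer; simp add: algebra_simps)+
  show "r *\<^sub>R (x + y) = r *\<^sub>R x + r *\<^sub>R y" "(r + s) *\<^sub>R x = r *\<^sub>R x + s *\<^sub>R x"
    "r *\<^sub>R s *\<^sub>R x = (r * s) *\<^sub>R x" "1 *\<^sub>R x = x"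
    by (transfer; simp add: algebra_simps)+
  show "a *\<^sub>C (x + y) = a *\<^sub>C x + a *\<^sub>C y" "(a + b) *\<^sub>C x = a *\<^sub>C x + b *\<^sub>C x"
    "a *\<^sub>C b *\<^sub>C x = (a * b) *\<^sub>C x" "complex_of_real r *\<^sub>C x = r *\<^sub>R x"
    by (transfer; simp add: algebra_simps)+
  show "dist x y = norm (x - y)"
    by (rule dist_ell2_def)
  show "sgn x = inverse (norm x) *\<^sub>R x"
    by (rule sgn_ell2_def)
  show "uniformity = (INF e\<in>{0 <..}. principal {(x, y :: 'a ell2). dist x y < e})"
    by (rule uniformity_ell2_def)
  show "open U \<longleftrightarrow> (\<forall>x\<in>U. eventually (\<lambda>(x', y). x' = x \<longrightarrow> y \<in> U) uniformity)"
    by (rule open_ell2_def)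
  show "norm x = 0 \<longleftrightarrow> x = 0"
  proof
    assume n: "norm x = 0"
    have "ell2_nth x i = 0" for i
      using L2_set_le_square_summable[OF ell2_summable, of "{i}" x] n by (simp add: norm_ell2.rep_eq)
    thus "x = 0"
      by (simp add: ell2_nth_inject[symmetric] zero_ell2.rep_eq fun_eq_iff)
  qed (transfer; simp)
  show "norm (x + y) \<le> norm x + norm y"
    by transfer (rule square_summable_add(2))
  show "norm (r *\<^sub>R x) = \<bar>r\<bar> * norm x"
    by transfer (simp add: norm_mult power_mult_distrib infsum_cmult_right' real_sqrt_mult)
  show "cinner x y = cnj (cinner y x)"
    by transfer (simp add: mult.commute flip: infsum_cnj)
  show "cinner (x + y) z = cinner x z + cinner y z"
    unfolding cinner_ell2.rep_eq plus_ell2.rep_eq distrib_right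
    by (intro infsum_add ell2_product_summable)
  show "cinner (a *\<^sub>C x) y = a * cinner x y"
    by transfer (simp add: mult.assoc infsum_cmult_right')
  show "norm x = sqrt (Re (cinner x x))"
    unfolding norm_ell2.rep_eq cinner_ell2.rep_eq complex_norm_square[symmetric]
    using has_sum_of_real[OF has_sum_infsum[OF ell2_summable[of x]], where 'a = complex]
    by (simp add: infsumI)
qed

end

lemma cmod_ell2_nth_le: "cmod (ell2_nth c i) \<le> norm c"
  using L2_set_le_square_summable[OF ell2_summable, of "{i}" c] by (simp add: norm_ell2.rep_eq)

instance ell2 :: (type) chilbert_space
proof
  fix X :: "nat \<Rightarrow> 'a ell2"
  assume X: "Cauchy X"
  have "\<exists>l. (\<lambda>n. ell2_nth (X n) i) \<longlonglongrightarrow> l" for i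
  proof -
    have "Cauchy (\<lambda>n. ell2_nth (X n) i)"
    proof (rule metric_CauchyI)
      fix e :: real assume "0 < e"
      then obtain M where M: "\<And>m n. m \<ge> M \<Longrightarrow> n \<ge> M \<Longrightarrow> dist (X m) (X n) < e"
        using metric_CauchyD[OF X] by blast
      have "dist (ell2_nth (X m) i) (ell2_nth (X n) i) \<le> dist (X m) (X n)" for m n
        using cmod_ell2_nth_le[of "X m - X n" i] by (simp add: dist_norm minus_ell2.rep_eq)
      thus "\<exists>M. \<forall>m\<ge>M. \<forall>n\<ge>M. dist (ell2_nth (X m) i) (ell2_nth (X n) i) < e"
        using M order_le_less_trans by blast
    qed
    thus ?thesis
      by (simp add: Cauchy_convergent_iff convergent_def)
  qed
  then obtain l where l: "\<And>i. (\<lambda>n. ell2_nth (X n) i) \<longlonglongrightarrow> l i"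
    by metis
  have near: "\<exists>M. \<forall>m\<ge>M. \<forall>F. finite F \<longrightarrow> L2_set (\<lambda>i. cmod (ell2_nth (X m) i - l i)) F \<le> e"
    if "0 < e" for e :: real
  proof -
    obtain M where M: "\<And>m n. m \<ge> M \<Longrightarrow> n \<ge> M \<Longrightarrow> dist (X m) (X n) < e"
      using metric_CauchyD[OF X \<open>0 < e\<close>] by blast
    have "L2_set (\<lambda>i. cmod (ell2_nth (X m) i - l i)) F \<le> e" if "m \<ge> M" "finite F" for m F
    proof (rule LIMSEQ_le_const2)
      show "(\<lambda>n. L2_set (\<lambda>i. cmod (ell2_nth (X m) i - ell2_nth (X n) i)) F)
              \<longlonglongrightarrow> L2_set (\<lambda>i. cmod (ell2_nth (X m) i - l i)) F"
        unfolding L2_set_def by (intro tendsto_intros l)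
      have "L2_set (\<lambda>i. cmod (ell2_nth (X m) i - ell2_nth (X n) i)) F \<le> e" if "n \<ge> M" for n
        using L2_set_le_square_summable[OF ell2_summable \<open>finite F\<close>, of "X m - X n"] M[OF \<open>m \<ge> M\<close> that]
        by (simp add: dist_norm norm_ell2.rep_eq minus_ell2.rep_eq)
      thus "\<exists>N. \<forall>n\<ge>N. L2_set (\<lambda>i. cmod (ell2_nth (X m) i - ell2_nth (X n) i)) F \<le> e"
        by blast
    qed
    thus ?thesis
      by blast
  qed
  have "(\<lambda>i. (cmod (l i))\<^sup>2) summable_on UNIV"
  proof -
    obtain m where m: "\<And>F. finite F \<Longrightarrow> L2_set (\<lambda>i. cmod (ell2_nth (X m) i - l i)) F \<le> 1"
      using near[of 1] by auto
    have "L2_set (\<lambda>i. cmod (l i)) F \<le> norm (X m) + 1" if "finite F" for F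
      using L2_set_cmod_add[of "ell2_nth (X m)" "\<lambda>i. - (ell2_nth (X m) i - l i)" F] m[OF that]
        L2_set_le_square_summable[OF ell2_summable that, of "X m"]
      by (simp add: norm_ell2.rep_eq norm_minus_commute)
    thus ?thesis
      by (rule square_summableI)
  qed
  then obtain L where L: "ell2_nth L = l"
    using ell2_nth_cases[of l] by auto
  have "X \<longlonglongrightarrow> L"
  proof (rule metric_LIMSEQ_I)
    fix e :: real assume "0 < e"
    then obtain M where M: "\<And>m F. m \<ge> M \<Longrightarrow> finite F \<Longrightarrow>
        L2_set (\<lambda>i. cmod (ell2_nth (X m) i - l i)) F \<le> e / 2"
      using near[of "e / 2"] by auto
    have "dist (X m) L \<le> e / 2" if "m \<ge> M" for m
      using square_summableI(2)[of "\<lambda>i. ell2_nth (X m) i - l i", OF M[OF that]]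
      by (simp add: dist_norm norm_ell2.rep_eq minus_ell2.rep_eq L)
    thus "\<exists>M. \<forall>m\<ge>M. dist (X m) L < e"
      using \<open>0 < e\<close> by (intro exI[of _ M]) fastforce
  qed
  thus "convergent X"
    by (rule convergentI)
qed

section \<open>Bessel sequences, frames and Riesz bases\<close>

definition bessel_sequence :: "('i \<Rightarrow> 'h::complex_inner) \<Rightarrow> real \<Rightarrow> bool" where
  "bessel_sequence \<Phi> B \<longleftrightarrow> 0 < B \<and>
     (\<forall>f. (\<lambda>i. (cmod (cinner f (\<Phi> i)))\<^sup>2) summable_on UNIV \<and>
          (\<Sum>\<^sub>\<infinity>i. (cmod (cinner f (\<Phi> i)))\<^sup>2) \<le> B * (norm f)\<^sup>2)"

text \<open>The bounds \<open>A\<close>, \<open>B\<close> are any valid bounds, not necessarily the optimal ones.\<close>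

definition frame :: "('i \<Rightarrow> 'h::complex_inner) \<Rightarrow> real \<Rightarrow> real \<Rightarrow> bool" where
  "frame \<Phi> A B \<longleftrightarrow> bessel_sequence \<Phi> B \<and> 0 < A \<and>
     (\<forall>f. A * (norm f)\<^sup>2 \<le> (\<Sum>\<^sub>\<infinity>i. (cmod (cinner f (\<Phi> i)))\<^sup>2))"

definition synthesis :: "('i \<Rightarrow> 'h::complex_inner) \<Rightarrow> 'i ell2 \<Rightarrow> 'h" where
  "synthesis \<Phi> c = (\<Sum>\<^sub>\<infinity>i. ell2_nth c i *\<^sub>C \<Phi> i)"

definition orthonormal_basis :: "('i \<Rightarrow> 'h::complex_inner) \<Rightarrow> bool" where
  "orthonormal_basis e \<longleftrightarrow>
     (\<forall>i j. cinner (e i) (e j) = (if i = j then 1 else 0)) \<and> closure (cspan (range e)) = UNIV"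

definition riesz_basis :: "('i \<Rightarrow> 'h::complex_inner) \<Rightarrow> bool" where
  "riesz_basis \<Phi> \<longleftrightarrow>
     (\<exists>(e :: 'i \<Rightarrow> 'h) (T :: 'h \<Rightarrow> 'h).
        orthonormal_basis e \<and> bounded_clinear T \<and> bij T \<and> (\<forall>i. \<Phi> i = T (e i)))"

section \<open>Cross Gram matrices\<close>

definition cross_gram ::
  "('h::complex_inner \<Rightarrow> 'h) \<Rightarrow> ('i \<Rightarrow> 'h) \<Rightarrow> ('i \<Rightarrow> 'h) \<Rightarrow> 'i \<Rightarrow> 'i \<Rightarrow> complex" where
  "cross_gram U \<Phi> \<Psi> i j = cinner (U (\<Psi> j)) (\<Phi> i)"

text \<open>\<open>T\<close> is the bounded operator on the sequence space that acts as multiplication by the matrix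
  \<open>M\<close>; there is at most one such \<open>T\<close>.\<close>

definition matrix_operator :: "('i \<Rightarrow> 'i \<Rightarrow> complex) \<Rightarrow> ('i ell2 \<Rightarrow> 'i ell2) \<Rightarrow> bool" where
  "matrix_operator M T \<longleftrightarrow> bounded_clinear T \<and>
     (\<forall>c i. ((\<lambda>j. M i j * ell2_nth c j) has_sum ell2_nth (T c) i) UNIV)"

definition ell2_invertible :: "('i \<Rightarrow> 'i \<Rightarrow> complex) \<Rightarrow> bool" where
  "ell2_invertible M \<longleftrightarrow> (\<exists>T. matrix_operator M T \<and> invertible_operator T)"

end

theory Submission
  imports Defs
begin

text \<open>
  Write \<open>T\<^sub>X\<close> for the synthesis operator of a Bessel sequence \<open>X\<close> and \<open>T\<^sub>X\<^sup>*\<close> for its adjoint, the analysis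
  operator \<open>f \<mapsto> (\<langle>f, x\<^sub>i\<rangle>)\<^sub>i\<close>. The cross Gram matrix of \<open>V\<close>, \<open>\<Xi>\<close>, \<open>\<Theta>\<close> is the operator \<open>T\<^sub>\<Xi>\<^sup>* V T\<^sub>\<Theta>\<close>, so
  it is enough that the three factors are invertible.

  This holds for the unperturbed data. For a frame the operator \<open>T\<^sub>\<Phi> T\<^sub>\<Phi>\<^sup>*\<close> is invertible, because it is close to a
  multiple of the identity (\<open>invertible_frame_operator\<close>). Hence \<open>T\<^sub>\<Psi>\<close> is onto, and invertibility of
  \<open>T\<^sub>\<Phi>\<^sup>* U T\<^sub>\<Psi>\<close> forces it to be injective; dually for \<open>T\<^sub>\<Phi>\<^sup>*\<close>. So \<open>T\<^sub>\<Phi>\<close>, \<open>T\<^sub>\<Psi>\<close> and \<open>U\<close> are all invertible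
  (\<open>invertible_cross_gram_frames\<close>).

  Invertibility survives a perturbation that is smaller than a lower bound of the operator
  (\<open>invertible_perturbation\<close>). The lower bound of \<open>T\<^sub>\<Phi>\<close> is \<open>sqrt A\<^sub>\<Phi>\<close> (\<open>norm_synthesis_ge\<close>). Every synthesis
  operator has norm at most \<open>sqrt B\<close>, so the hypothesis on the four families gives
  \<open>\<parallel>T\<^sub>\<Phi> - T\<^sub>\<Xi>\<parallel> \<le> l sqrt B\<close>, and \<open>l sqrt B < sqrt A\<close> follows from the last hypothesis on \<open>l\<close>. The same
  argument applies to \<open>\<Psi>\<close> and \<open>\<Theta>\<close>. For \<open>U\<close> the lower bound is \<open>1 / \<parallel>U\<inverse>\<parallel>\<close>, which exceeds \<open>\<parallel>U - V\<parallel>\<close> because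
  \<open>sqrt (A\<^sub>\<Psi> A\<^sub>\<Phi>) \<le> B\<close>.

  Finally, a Bessel sequence with invertible synthesis operator is a Riesz basis (\<open>riesz_basisI\<close>). The
  orthonormal basis with the same index set comes from the Gram-Schmidt process along an enumeration of
  the indices.
\<close>

section \<open>Complex inner products\<close>

lemma cinner_self: "cinner x x = complex_of_real ((norm x)\<^sup>2)"
proof -
  have "cinner x x = cnj (cinner x x)"
    by (rule cinner_commute)
  from arg_cong[OF this, of Im] have im: "Im (cinner x x) = 0"
    by simp
  have "0 \<le> sqrt (Re (cinner x x))"
    using norm_eq_sqrt_cinner[of x] norm_ge_zero[of x] by simp
  hence "0 \<le> Re (cinner x x)"
    by simp
  hence "(norm x)\<^sup>2 = Re (cinner x x)"
    by (simp add: norm_eq_sqrt_cinner)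
  thus ?thesis
    using im by (simp add: complex_eq_iff)
qed

lemma cinner_add_right: "cinner x (y + z) = cinner x y + cinner x z"
  by (metis cinner_add_left cinner_commute complex_cnj_add)

lemma cinner_scaleC_right: "cinner x (a *\<^sub>C y) = cnj a * cinner x y"
  by (metis cinner_commute cinner_scaleC_left complex_cnj_mult)

lemma cinner_zero_left [simp]: "cinner 0 y = 0"
  using cinner_add_left[of 0 0 y] by simp

lemma cinner_zero_right [simp]: "cinner x 0 = 0"
  using cinner_add_right[of x 0 0] by simp

lemma cinner_diff_left: "cinner (x - y) z = cinner x z - cinner y z"
  using cinner_add_left[of "x - y" y z] by simp

lemma cinner_diff_right: "cinner x (y - z) = cinner x y - cinner x z"
  using cinner_add_right[of x "y - z" z] by simp

lemma cinner_sum_left: "cinner (\<Sum>i\<in>F. f i) y = (\<Sum>i\<in>F. cinner (f i) y)"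
  by (induction F rule: infinite_finite_induct) (auto simp: cinner_add_left)

lemma cinner_scaleR_left: "cinner (r *\<^sub>R x) y = complex_of_real r * cinner x y"
  by (simp add: cinner_scaleC_left flip: scaleC_of_real)

lemma norm_diff_squared:
  "(norm (x - y))\<^sup>2 = (norm x)\<^sup>2 - 2 * Re (cinner x y) + (norm y)\<^sup>2"
proof -
  have "complex_of_real ((norm (x - y))\<^sup>2) =
      complex_of_real ((norm x)\<^sup>2) - (cinner x y + cnj (cinner x y)) + complex_of_real ((norm y)\<^sup>2)"
    unfolding cinner_self[symmetric] cinner_commute[of y x, symmetric]
    by (simp add: cinner_diff_left cinner_diff_right)
  from arg_cong[OF this, of Re] show ?thesis
    by simp
qed

lemma norm_scaleC: "norm (a *\<^sub>C x) = cmod a * norm x"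
proof -
  have "complex_of_real ((norm (a *\<^sub>C x))\<^sup>2) = complex_of_real ((cmod a * norm x)\<^sup>2)"
  proof -
    have "complex_of_real ((norm (a *\<^sub>C x))\<^sup>2) = (a * cnj a) * cinner x x"
      by (simp only: cinner_self[symmetric] cinner_scaleC_left cinner_scaleC_right mult.assoc mult.left_commute)
    also have "\<dots> = complex_of_real ((cmod a * norm x)\<^sup>2)"
      by (simp only: complex_norm_square[symmetric] cinner_self power_mult_distrib of_real_mult)
    finally show ?thesis .
  qed
  thus ?thesis
    by (metis of_real_eq_iff norm_ge_zero power2_eq_imp_eq mult_nonneg_nonneg)
qed

lemma cauchy_schwarz: "cmod (cinner x y) \<le> norm x * norm y"
proof (cases "y = 0")
  case False
  define n where "n = norm y"
  have n: "n > 0"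
    using False by (simp add: n_def)
  \<comment> \<open>\<open>t\<close> times \<open>y\<close> is the orthogonal projection of \<open>x\<close> onto the line of \<open>y\<close>.\<close>
  define t where "t = cinner x y / complex_of_real (n\<^sup>2)"
  have "cinner x (t *\<^sub>C y) = complex_of_real ((cmod (cinner x y))\<^sup>2 / n\<^sup>2)"
    by (simp only: cinner_scaleC_right t_def complex_cnj_divide complex_cnj_complex_of_real
        of_real_divide complex_norm_square mult.commute times_divide_eq_right)
  hence "Re (cinner x (t *\<^sub>C y)) = (cmod (cinner x y))\<^sup>2 / n\<^sup>2"
    by (simp only: Re_complex_of_real)
  moreover have "(norm (t *\<^sub>C y))\<^sup>2 = (cmod (cinner x y))\<^sup>2 / n\<^sup>2"
    using n by (simp add: norm_scaleC t_def norm_divide norm_mult norm_power n_def[symmetric] power2_eq_square)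
  ultimately have "0 \<le> (norm x)\<^sup>2 - (cmod (cinner x y))\<^sup>2 / n\<^sup>2"
    using norm_diff_squared[of x "t *\<^sub>C y"] zero_le_power2[of "norm (x - t *\<^sub>C y)"] by linarith
  hence "(cmod (cinner x y))\<^sup>2 \<le> (norm x * n)\<^sup>2"
    using n by (simp add: field_simps)
  thus ?thesis
    unfolding n_def by (rule power2_le_imp_le) simp
qed simp

lemma bounded_linear_cinner_left: "bounded_linear (\<lambda>x. cinner x y)"
  by (rule bounded_linear_intro[where K = "norm y"])
     (auto simp: cinner_add_left cinner_scaleR_left cauchy_schwarz scaleR_conv_of_real)

section \<open>Invertible operators\<close>

lemma bounded_clinear_bounded_linear: "bounded_clinear T \<Longrightarrow> bounded_linear T"
  by (simp add: bounded_clinear_def)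

lemma bounded_clinear_diff: "bounded_clinear T \<Longrightarrow> T (x - y) = T x - T y"
  by (simp add: bounded_clinear_def linear_diff bounded_linear.linear)

lemma bounded_clinearI:
  assumes "\<And>x y. T (x + y) = T x + T y" "\<And>a x. T (a *\<^sub>C x) = a *\<^sub>C T x"
    "\<And>x. norm (T x) \<le> K * norm x"
  shows "bounded_clinear T"
proof -
  have "T (r *\<^sub>R x) = r *\<^sub>R T x" for r x
    using assms(2)[of "complex_of_real r" x] by (simp only: scaleC_of_real)
  hence "bounded_linear T"
    by (intro bounded_linear_intro[where K = K]) (simp_all add: assms mult.commute)
  thus ?thesis
    by (simp add: bounded_clinear_def assms)
qed

lemma bounded_clinear_compose:
  "bounded_clinear S \<Longrightarrow> bounded_clinear T \<Longrightarrow> bounded_clinear (S \<circ> T)"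
  by (auto simp: bounded_clinear_def o_def intro: bounded_linear_compose)

lemma invertible_operator_compose:
  assumes "invertible_operator S" "invertible_operator T"
  shows "invertible_operator (S \<circ> T)"
proof -
  obtain S' T' where "bounded_clinear S'" "S' \<circ> S = id" "S \<circ> S' = id"
      "bounded_clinear T'" "T' \<circ> T = id" "T \<circ> T' = id"
    using assms by (auto simp: invertible_operator_def)
  hence "bounded_clinear (T' \<circ> S') \<and> (T' \<circ> S') \<circ> (S \<circ> T) = id \<and> (S \<circ> T) \<circ> (T' \<circ> S') = id"
    by (simp add: bounded_clinear_compose fun_eq_iff)
  thus ?thesis
    using assms by (auto simp: invertible_operator_def bounded_clinear_compose)
qed

lemma invertible_operator_bij: "invertible_operator T \<Longrightarrow> bij T"
  unfolding invertible_operator_def using o_bij by blast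

lemma invertible_operator_inv:
  assumes "invertible_operator T"
  shows "invertible_operator (inv T)"
proof -
  obtain S where S: "bounded_clinear S" "S \<circ> T = id" "T \<circ> S = id"
    using assms by (auto simp: invertible_operator_def)
  hence "inv T = S"
    by (simp add: inv_unique_comp)
  thus ?thesis
    using assms S by (auto simp: invertible_operator_def)
qed

text \<open>
  A lower bound on \<open>T\<close> is an upper bound on the inverse, which makes the inverse continuous.
\<close>

lemma invertible_operatorI_bij:
  assumes T: "bounded_clinear T" "bij T" and a: "0 < a" "\<And>x. a * norm x \<le> norm (T x)"
  shows "invertible_operator T"
proof -
  have inv: "T (inv T y) = y" "inv T (T x) = x" for x y
    using T(2) by (simp_all add: bij_is_surj surj_f_inv_f bij_is_inj)
  have "bounded_clinear (inv T)"
  proof (rule bounded_clinearI[where K = "1 / a"])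
    show "inv T (x + y) = inv T x + inv T y" for x y
    proof -
      have "T (inv T x + inv T y) = x + y"
        using T(1) by (simp add: bounded_clinear_def bounded_linear.linear linear_add inv)
      from arg_cong[OF this, of "inv T"] show ?thesis
        by (simp add: inv)
    qed
    show "inv T (b *\<^sub>C x) = b *\<^sub>C inv T x" for b x
    proof -
      have "T (b *\<^sub>C inv T x) = b *\<^sub>C x"
        using T(1) by (simp add: bounded_clinear_def inv)
      from arg_cong[OF this, of "inv T"] show ?thesis
        by (simp add: inv)
    qed
    show "norm (inv T y) \<le> 1 / a * norm y" for y
      using a(2)[of "inv T y"] a(1) by (simp add: inv field_simps)
  qed
  thus ?thesis
    using T(1) inv by (auto simp: invertible_operator_def fun_eq_iff)
qed

text \<open>
  An equation \<open>R x = y\<close> is the same as \<open>x = T\<inverse> (y + (T x - R x))\<close>. The inverse of \<open>T\<close> shrinks by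
  \<open>1 / a\<close> and \<open>T - R\<close> stretches by at most \<open>b\<close>, so the right-hand side is a contraction in \<open>x\<close> and has a
  fixed point. This form of the Neumann series is what every stability statement below rests on.
\<close>

lemma invertible_perturbation:
  fixes T R :: "'a::chilbert_space \<Rightarrow> 'b::complex_inner"
  assumes T: "invertible_operator T" and R: "bounded_clinear R"
    and a: "\<And>x. a * norm x \<le> norm (T x)"
    and b: "\<And>x. norm (T x - R x) \<le> b * norm x" and ba: "0 \<le> b" "b < a"
  shows "invertible_operator R"
proof (rule invertible_operatorI_bij[OF R])
  have Tinv: "T (inv T y) = y" for y
    using invertible_operator_bij[OF T] by (simp add: bij_is_surj surj_f_inv_f)
  have Tdiff: "T (x - y) = T x - T y" for x y
    using T by (simp add: invertible_operator_def bounded_clinear_diff)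
  show below: "(a - b) * norm x \<le> norm (R x)" for x
    using a[of x] b[of x] norm_triangle_ineq2[of "T x" "T x - R x"] by (simp add: left_diff_distrib)
  show "0 < a - b"
    using ba by simp
  have "inj R"
  proof (rule injI)
    fix x y assume "R x = R y"
    hence "(a - b) * norm (x - y) \<le> 0"
      using below[of "x - y"] by (simp add: bounded_clinear_diff[OF R])
    thus "x = y"
      using ba by (simp add: mult_le_0_iff)
  qed
  moreover have "\<exists>x. R x = y" for y
  proof -
    define g where "g x = inv T (y + (T x - R x))" for x
    have Tg: "T (g x) = y + (T x - R x)" for x
      by (simp add: g_def Tinv)
    have "dist (g x) (g x') \<le> b / a * dist x x'" for x x'
    proof -
      have "a * norm (g x - g x') \<le> norm (T (x - x') - R (x - x'))"
        using a[of "g x - g x'"] by (simp add: Tdiff Tg bounded_clinear_diff[OF R] algebra_simps)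
      also have "\<dots> \<le> b * norm (x - x')"
        by (rule b)
      finally show ?thesis
        using ba by (simp add: dist_norm field_simps)
    qed
    then obtain x where "g x = x"
      using banach_fix_type[of "b / a" g] ba by auto
    hence "R x = y"
      using Tg[of x] by simp
    thus ?thesis ..
  qed
  ultimately show "bij R"
    by (metis bij_betw_def surj_def)
qed

section \<open>Synthesis and analysis operators\<close>

text \<open>
  The Cauchy criterion for unconditional convergence.
\<close>

lemma summable_on_if_small_disjoint_sums:
  fixes f :: "'i \<Rightarrow> 'a::{real_normed_vector, complete_space}"
  assumes "\<And>e. 0 < e \<Longrightarrow> \<exists>F. finite F \<and> (\<forall>G. finite G \<and> G \<inter> F = {} \<longrightarrow> norm (sum f G) < e)"
  shows "f summable_on UNIV"
proof -
  have "\<exists>P. eventually P (finite_subsets_at_top UNIV) \<and>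
          (\<forall>X Y. P X \<and> P Y \<longrightarrow> dist (sum f X) (sum f Y) < e)" if "0 < e" for e
  proof -
    obtain F where F: "finite F" "\<And>G. finite G \<Longrightarrow> G \<inter> F = {} \<Longrightarrow> norm (sum f G) < e / 2"
      using assms[of "e / 2"] \<open>0 < e\<close> by auto
    have near: "norm (sum f X - sum f F) < e / 2" if "finite X" "F \<subseteq> X" for X
      using F(2)[of "X - F"] that by (simp add: sum_diff Diff_Int_distrib2)
    have "dist (sum f X) (sum f Y) < e" if "finite X \<and> F \<subseteq> X" "finite Y \<and> F \<subseteq> Y" for X Y
      using dist_triangle_half_l[of "sum f X" "sum f F" e "sum f Y"] near[of X] near[of Y] that
      by (simp add: dist_norm)
    moreover have "eventually (\<lambda>X. finite X \<and> F \<subseteq> X) (finite_subsets_at_top UNIV)"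
      using F(1) by (auto simp: eventually_finite_subsets_at_top)
    ultimately show ?thesis
      by blast
  qed
  hence "cauchy_filter (filtermap (sum f) (finite_subsets_at_top UNIV))"
    by (simp add: cauchy_filter_metric_filtermap)
  hence "\<exists>L. filtermap (sum f) (finite_subsets_at_top UNIV) \<le> nhds L"
    by (simp add: convergent_filter_iff_cauchy[symmetric] convergent_filter_iff)
  thus ?thesis
    by (auto simp: summable_on_def has_sum_def filterlim_def)
qed

text \<open>
  The adjoint of the synthesis operator. For a family that is not Bessel the sequence may fail to be
  square summable, and then the value is arbitrary.
\<close>

definition analysis :: "('i \<Rightarrow> 'h::complex_inner) \<Rightarrow> 'h \<Rightarrow> 'i ell2" where
  "analysis \<Phi> f = Abs_ell2 (\<lambda>i. cinner f (\<Phi> i))"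

lemma ell2_nth_analysis:
  "bessel_sequence \<Phi> B \<Longrightarrow> ell2_nth (analysis \<Phi> f) i = cinner f (\<Phi> i)"
  by (simp add: analysis_def Abs_ell2_inverse bessel_sequence_def)

lemma norm_analysis:
  "bessel_sequence \<Phi> B \<Longrightarrow> (norm (analysis \<Phi> f))\<^sup>2 = (\<Sum>\<^sub>\<infinity>i. (cmod (cinner f (\<Phi> i)))\<^sup>2)"
  by (simp add: norm_ell2.rep_eq ell2_nth_analysis infsum_nonneg)

lemma norm_analysis_le:
  assumes "bessel_sequence \<Phi> B"
  shows "norm (analysis \<Phi> f) \<le> sqrt B * norm f"
proof (rule power2_le_imp_le)
  show "(norm (analysis \<Phi> f))\<^sup>2 \<le> (sqrt B * norm f)\<^sup>2"
    using assms by (simp add: norm_analysis[OF assms] bessel_sequence_def power_mult_distrib)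
  show "0 \<le> sqrt B * norm f"
    using assms by (simp add: bessel_sequence_def)
qed

lemma bounded_clinear_analysis:
  assumes "bessel_sequence \<Phi> B"
  shows "bounded_clinear (analysis \<Phi>)"
proof (rule bounded_clinearI)
  show "norm (analysis \<Phi> f) \<le> sqrt B * norm f" for f
    by (rule norm_analysis_le[OF assms])
qed (auto simp: ell2_nth_inject[symmetric] fun_eq_iff ell2_nth_analysis[OF assms]
       plus_ell2.rep_eq scaleC_ell2.rep_eq cinner_add_left cinner_scaleC_left)

text \<open>
  Duality with the analysis operator: pairing the sum \<open>v\<close> with itself gives \<open>\<Sum> c\<^sub>i \<langle>\<phi>\<^sub>i, v\<rangle>\<close>, and the
  Bessel bound for \<open>f = v\<close> controls the second factor after the Cauchy-Schwarz inequality.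
\<close>

lemma norm_finite_synthesis_le:
  assumes "bessel_sequence \<Phi> B" "finite F"
  shows "norm (\<Sum>i\<in>F. c i *\<^sub>C \<Phi> i) \<le> sqrt B * L2_set (\<lambda>i. cmod (c i)) F"
proof -
  define v where "v = (\<Sum>i\<in>F. c i *\<^sub>C \<Phi> i)"
  have "complex_of_real ((norm v)\<^sup>2) = (\<Sum>i\<in>F. c i * cnj (cinner v (\<Phi> i)))"
    unfolding cinner_self[symmetric]
    by (subst (1) v_def) (simp add: cinner_sum_left cinner_scaleC_left flip: cinner_commute)
  from arg_cong[OF this, of cmod]
  have "(norm v)\<^sup>2 = cmod (\<Sum>i\<in>F. c i * cnj (cinner v (\<Phi> i)))"
    by (simp only: norm_of_real abs_power2)
  also have "\<dots> \<le> (\<Sum>i\<in>F. \<bar>cmod (c i)\<bar> * \<bar>cmod (cinner v (\<Phi> i))\<bar>)"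
    by (rule sum_norm_le) (simp add: norm_mult)
  also have "\<dots> \<le> L2_set (\<lambda>i. cmod (c i)) F * L2_set (\<lambda>i. cmod (cinner v (\<Phi> i))) F"
    by (rule L2_set_mult_ineq)
  also have "\<dots> \<le> L2_set (\<lambda>i. cmod (c i)) F * (sqrt B * norm v)"
    using L2_set_le_square_summable[OF ell2_summable assms(2), of "analysis \<Phi> v"]
      norm_analysis_le[OF assms(1), of v]
    by (intro mult_left_mono) (simp_all add: ell2_nth_analysis[OF assms(1)] norm_ell2.rep_eq)
  finally have "norm v * norm v \<le> (sqrt B * L2_set (\<lambda>i. cmod (c i)) F) * norm v"
    by (simp add: power2_eq_square mult_ac)
  moreover have "0 \<le> sqrt B * L2_set (\<lambda>i. cmod (c i)) F"
    using assms(1) by (simp add: bessel_sequence_def)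
  ultimately show ?thesis
    unfolding v_def[symmetric] by (cases "v = 0") simp_all
qed

text \<open>
  The tails of a square summable sequence are small, and the finite synthesis estimate carries this
  over to the sums in the Hilbert space.
\<close>

lemma synthesis_has_sum:
  fixes \<Phi> :: "'i \<Rightarrow> 'h::chilbert_space"
  assumes "bessel_sequence \<Phi> B"
  shows "((\<lambda>i. ell2_nth c i *\<^sub>C \<Phi> i) has_sum synthesis \<Phi> c) UNIV"
proof -
  have B: "0 < B"
    using assms by (simp add: bessel_sequence_def)
  let ?q = "\<lambda>i. (cmod (ell2_nth c i))\<^sup>2"
  have "(\<lambda>i. ell2_nth c i *\<^sub>C \<Phi> i) summable_on UNIV"
  proof (rule summable_on_if_small_disjoint_sums)
    fix e :: real assume e: "0 < e"
    \<comment> \<open>Tails of squared norm \<open>d\<close> have synthesis of norm at most \<open>sqrt B * sqrt d = e / 2\<close>.\<close>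
    define d where "d = (e / 2)\<^sup>2 / B"
    have d: "0 < d"
      using e B by (simp add: d_def)
    obtain F where F: "finite F" "dist (sum ?q F) (infsum ?q UNIV) \<le> d"
      using has_sum_finite_approximation[OF has_sum_infsum[OF ell2_summable[of c]] d] by auto
    have "norm (\<Sum>i\<in>G. ell2_nth c i *\<^sub>C \<Phi> i) < e" if G: "finite G" "G \<inter> F = {}" for G
    proof -
      have "sum ?q G + sum ?q F \<le> infsum ?q UNIV"
        using finite_sum_le_infsum[OF ell2_summable, of "G \<union> F" c] F(1) G
        by (simp add: sum.union_disjoint)
      hence "sum ?q G \<le> d"
        using F(2) by (simp add: dist_real_def)
      hence "L2_set (\<lambda>i. cmod (ell2_nth c i)) G \<le> sqrt d"
        by (simp add: L2_set_def)
      hence "sqrt B * L2_set (\<lambda>i. cmod (ell2_nth c i)) G \<le> sqrt B * sqrt d"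
        using B by (intro mult_left_mono) simp_all
      also have "\<dots> = e / 2"
        using B e by (simp add: d_def real_sqrt_divide)
      finally show ?thesis
        using norm_finite_synthesis_le[OF assms G(1), of "ell2_nth c"] e by simp
    qed
    thus "\<exists>F. finite F \<and> (\<forall>G. finite G \<and> G \<inter> F = {} \<longrightarrow> norm (\<Sum>i\<in>G. ell2_nth c i *\<^sub>C \<Phi> i) < e)"
      using F(1) by blast
  qed
  thus ?thesis
    by (simp add: synthesis_def)
qed

lemma cinner_synthesis:
  fixes \<Phi> :: "'i \<Rightarrow> 'h::chilbert_space"
  assumes "bessel_sequence \<Phi> B"
  shows "cinner (synthesis \<Phi> c) f = cinner c (analysis \<Phi> f)"
proof (rule has_sum_unique)
  show "((\<lambda>i. ell2_nth c i * cinner (\<Phi> i) f) has_sum cinner (synthesis \<Phi> c) f) UNIV"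
    using has_sum_bounded_linear[OF bounded_linear_cinner_left synthesis_has_sum[OF assms]]
    by (simp add: o_def cinner_scaleC_left)
  have "cnj (cinner f (\<Phi> i)) = cinner (\<Phi> i) f" for i
    by (rule cinner_commute[symmetric])
  with has_sum_infsum[OF ell2_product_summable, of c "analysis \<Phi> f"]
  show "((\<lambda>i. ell2_nth c i * cinner (\<Phi> i) f) has_sum cinner c (analysis \<Phi> f)) UNIV"
    by (simp only: ell2_nth_analysis[OF assms] cinner_ell2.rep_eq)
qed

lemma norm_synthesis_le:
  fixes \<Phi> :: "'i \<Rightarrow> 'h::chilbert_space"
  assumes "bessel_sequence \<Phi> B"
  shows "norm (synthesis \<Phi> c) \<le> sqrt B * norm c"
proof -
  have "complex_of_real ((norm (synthesis \<Phi> c))\<^sup>2) = cinner c (analysis \<Phi> (synthesis \<Phi> c))"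
    by (simp only: cinner_self[symmetric] cinner_synthesis[OF assms])
  from arg_cong[OF this, of cmod]
  have "(norm (synthesis \<Phi> c))\<^sup>2 = cmod (cinner c (analysis \<Phi> (synthesis \<Phi> c)))"
    by (simp only: norm_of_real abs_power2)
  also have "\<dots> \<le> norm c * norm (analysis \<Phi> (synthesis \<Phi> c))"
    by (rule cauchy_schwarz)
  also have "\<dots> \<le> norm c * (sqrt B * norm (synthesis \<Phi> c))"
    by (intro mult_left_mono norm_analysis_le[OF assms]) simp
  finally have "norm (synthesis \<Phi> c) * norm (synthesis \<Phi> c) \<le> (sqrt B * norm c) * norm (synthesis \<Phi> c)"
    by (simp add: power2_eq_square mult_ac)
  moreover have "0 \<le> sqrt B * norm c"
    using assms by (simp add: bessel_sequence_def)
  ultimately show ?thesis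
    by (cases "synthesis \<Phi> c = 0") simp_all
qed

lemma bounded_linear_scaleC: "bounded_linear (\<lambda>x :: 'a::complex_inner. a *\<^sub>C x)"
proof (rule bounded_linear_intro[where K = "cmod a"])
  show "a *\<^sub>C r *\<^sub>R x = r *\<^sub>R a *\<^sub>C x" for r and x :: 'a
    by (simp only: scaleC_of_real[symmetric] scaleC_scaleC mult.commute)
qed (simp_all add: scaleC_add_right norm_scaleC mult.commute)

lemma bounded_clinear_synthesis:
  fixes \<Phi> :: "'i \<Rightarrow> 'h::chilbert_space"
  assumes "bessel_sequence \<Phi> B"
  shows "bounded_clinear (synthesis \<Phi>)"
proof (rule bounded_clinearI[OF _ _ norm_synthesis_le[OF assms]])
  fix c d :: "'i ell2" and a :: complex
  show "synthesis \<Phi> (c + d) = synthesis \<Phi> c + synthesis \<Phi> d"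
  proof (rule has_sum_unique[OF synthesis_has_sum[OF assms]])
    show "((\<lambda>i. ell2_nth (c + d) i *\<^sub>C \<Phi> i) has_sum synthesis \<Phi> c + synthesis \<Phi> d) UNIV"
      unfolding plus_ell2.rep_eq scaleC_add_left
      by (intro has_sum_add synthesis_has_sum[OF assms])
  qed
  show "synthesis \<Phi> (a *\<^sub>C c) = a *\<^sub>C synthesis \<Phi> c"
  proof (rule has_sum_unique[OF synthesis_has_sum[OF assms]])
    show "((\<lambda>i. ell2_nth (a *\<^sub>C c) i *\<^sub>C \<Phi> i) has_sum a *\<^sub>C synthesis \<Phi> c) UNIV"
      using has_sum_bounded_linear[OF bounded_linear_scaleC synthesis_has_sum[OF assms, of c], of a]
      by (simp only: o_def scaleC_scaleC scaleC_ell2.rep_eq)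
  qed
qed

lemma synthesis_diff:
  fixes \<Phi> \<Psi> :: "'i \<Rightarrow> 'h::chilbert_space"
  assumes "bessel_sequence \<Phi> B" "bessel_sequence \<Psi> B'"
  shows "synthesis (\<lambda>i. \<Phi> i - \<Psi> i) c = synthesis \<Phi> c - synthesis \<Psi> c"
proof -
  have "((\<lambda>i. ell2_nth c i *\<^sub>C (\<Phi> i - \<Psi> i)) has_sum synthesis \<Phi> c - synthesis \<Psi> c) UNIV"
    unfolding complex_vector.scale_right_diff_distrib
    unfolding diff_conv_add_uminus
    by (intro has_sum_add has_sum_uminus[THEN iffD2])
       (simp_all add: synthesis_has_sum[OF assms(1)] synthesis_has_sum[OF assms(2)])
  thus ?thesis
    by (simp add: synthesis_def infsumI)
qed

section \<open>Frame operators\<close>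

lemma bessel_sequence_mono: "bessel_sequence \<Phi> B \<Longrightarrow> B \<le> B' \<Longrightarrow> bessel_sequence \<Phi> B'"
  unfolding bessel_sequence_def by (meson less_le_trans mult_right_mono order_trans zero_le_power2)

lemma frame_bessel: "frame \<Phi> A B \<Longrightarrow> bessel_sequence \<Phi> B"
  by (simp add: frame_def)

lemma frame_bounds_le:
  fixes \<Phi> :: "'i \<Rightarrow> 'h::complex_inner"
  assumes "frame \<Phi> A B" and "(f :: 'h) \<noteq> 0"
  shows "A \<le> B"
proof -
  have "A * (norm f)\<^sup>2 \<le> B * (norm f)\<^sup>2"
    using assms(1) unfolding frame_def bessel_sequence_def by (meson order_trans)
  thus ?thesis
    using assms(2) by simp
qed

lemma norm_analysis_ge:
  assumes "frame \<Phi> A B"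
  shows "sqrt A * norm f \<le> norm (analysis \<Phi> f)"
proof (rule power2_le_imp_le)
  have "bessel_sequence \<Phi> B"
    using assms by (simp add: frame_def)
  thus "(sqrt A * norm f)\<^sup>2 \<le> (norm (analysis \<Phi> f))\<^sup>2"
    using assms by (simp add: norm_analysis frame_def power_mult_distrib)
qed simp

text \<open>
  The frame operator \<open>S\<close>, synthesis after analysis, is compared with \<open>B\<close> times the identity. If \<open>q\<close>
  is the squared norm of the analysis of \<open>f\<close>, then \<open>\<langle>S f, f\<rangle> = q\<close> and \<open>\<parallel>S f\<parallel>\<^sup>2 \<le> B q\<close>, whence
  \<open>\<parallel>B f - S f\<parallel>\<^sup>2 \<le> B\<^sup>2 \<parallel>f\<parallel>\<^sup>2 - B q \<le> (B\<^sup>2 - B a\<^sup>2) \<parallel>f\<parallel>\<^sup>2\<close>. This is a perturbation that is strictly smaller than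
  \<open>B\<close>.
\<close>

lemma invertible_frame_operator:
  fixes \<Phi> :: "'i \<Rightarrow> 'h::chilbert_space"
  assumes \<Phi>: "bessel_sequence \<Phi> B" and a: "0 < a" "\<And>f. a * norm f \<le> norm (analysis \<Phi> f)"
  shows "invertible_operator (synthesis \<Phi> \<circ> analysis \<Phi>)"
proof (rule invertible_perturbation)
  have B: "0 < B"
    using \<Phi> by (simp add: bessel_sequence_def)
  \<comment> \<open>On the zero space \<open>a\<^sup>2\<close> may exceed \<open>B\<close>; the maximum keeps the radicand nonnegative.\<close>
  define b where "b = sqrt (max 0 (B\<^sup>2 - B * a\<^sup>2))"
  show "0 \<le> b"
    by (simp add: b_def)
  have "max 0 (B\<^sup>2 - B * a\<^sup>2) < B\<^sup>2"
    using B a(1) by simp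
  thus "b < B"
    unfolding b_def using B by (metis real_sqrt_less_mono real_sqrt_abs abs_of_pos)
  show "B * norm f \<le> norm (B *\<^sub>R f)" for f :: 'h
    using B by simp
  show "bounded_clinear (synthesis \<Phi> \<circ> analysis \<Phi>)"
    by (intro bounded_clinear_compose bounded_clinear_synthesis[OF \<Phi>] bounded_clinear_analysis[OF \<Phi>])
  have "bounded_clinear (\<lambda>f :: 'h. r *\<^sub>R f)" for r
    by (rule bounded_clinearI[where K = "\<bar>r\<bar>"])
       (simp_all only: scaleC_of_real[symmetric] scaleC_add_right scaleC_scaleC mult.commute
          norm_scaleC norm_of_real order_refl)
  from this[of B] this[of "inverse B"] show "invertible_operator (\<lambda>f :: 'h. B *\<^sub>R f)"
    unfolding invertible_operator_def using B
    by (intro conjI exI[of _ "\<lambda>f. inverse B *\<^sub>R f"]) (auto simp: fun_eq_iff)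
  fix f
  define S where "S = synthesis \<Phi> (analysis \<Phi> f)"
  define q where "q = (norm (analysis \<Phi> f))\<^sup>2"
  have "cinner S f = complex_of_real q"
    by (simp only: S_def q_def cinner_synthesis[OF \<Phi>] cinner_self)
  hence "Re (cinner (B *\<^sub>R f) S) = B * q"
    by (simp add: cinner_scaleR_left cinner_commute[of f S])
  hence "(norm (B *\<^sub>R f - S))\<^sup>2 = B\<^sup>2 * (norm f)\<^sup>2 - 2 * (B * q) + (norm S)\<^sup>2"
    by (simp add: norm_diff_squared power_mult_distrib)
  moreover have "(norm S)\<^sup>2 \<le> B * q"
    using power_mono[OF norm_synthesis_le[OF \<Phi>, of "analysis \<Phi> f"], of 2] B
    by (simp add: S_def q_def power_mult_distrib)
  moreover have "B * (a\<^sup>2 * (norm f)\<^sup>2) \<le> B * q"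
    using power_mono[OF a(2)[of f], of 2] a(1) B by (simp add: q_def power_mult_distrib)
  ultimately have "(norm (B *\<^sub>R f - S))\<^sup>2 \<le> (B\<^sup>2 - B * a\<^sup>2) * (norm f)\<^sup>2"
    by (simp add: left_diff_distrib)
  also have "\<dots> \<le> max 0 (B\<^sup>2 - B * a\<^sup>2) * (norm f)\<^sup>2"
    by (intro mult_right_mono) simp_all
  also have "\<dots> = (b * norm f)\<^sup>2"
    by (simp add: b_def power_mult_distrib)
  finally have "norm (B *\<^sub>R f - S) \<le> b * norm f"
    by (rule power2_le_imp_le) (simp add: b_def)
  thus "norm (B *\<^sub>R f - (synthesis \<Phi> \<circ> analysis \<Phi>) f) \<le> b * norm f"
    by (simp add: S_def)
qed

lemma invertible_frame_operator_of_frame: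
  fixes \<Phi> :: "'i \<Rightarrow> 'h::chilbert_space"
  assumes "frame \<Phi> A B"
  shows "invertible_operator (synthesis \<Phi> \<circ> analysis \<Phi>)"
  using assms norm_analysis_ge[OF assms]
  by (intro invertible_frame_operator[where a = "sqrt A" and B = B]) (auto simp: frame_def)

lemma surj_synthesis_frame:
  fixes \<Phi> :: "'i \<Rightarrow> 'h::chilbert_space"
  shows "frame \<Phi> A B \<Longrightarrow> surj (synthesis \<Phi>)"
  using invertible_operator_bij[OF invertible_frame_operator_of_frame] by (metis bij_is_surj comp_apply surj_def)

text \<open>
  The frame operator is onto, so an injective synthesis operator makes every sequence \<open>c\<close> the analysis
  of some \<open>g\<close>. Then \<open>\<parallel>c\<parallel>\<^sup>2 = \<langle>synthesis \<Phi> c, g\<rangle>\<close>, and the lower frame bound compares \<open>\<parallel>g\<parallel>\<close> with \<open>\<parallel>c\<parallel>\<close>. So the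
  synthesis operator inherits the constant of the analysis operator.
\<close>

lemma norm_synthesis_ge:
  fixes \<Phi> :: "'i \<Rightarrow> 'h::chilbert_space"
  assumes "frame \<Phi> A B" and inj: "inj (synthesis \<Phi>)"
  shows "sqrt A * norm c \<le> norm (synthesis \<Phi> c)"
proof -
  have \<Phi>: "bessel_sequence \<Phi> B" and A: "0 < A"
    using assms(1) by (auto simp: frame_def)
  obtain g where "synthesis \<Phi> c = synthesis \<Phi> (analysis \<Phi> g)"
    using surjD[OF bij_is_surj[OF invertible_operator_bij[OF invertible_frame_operator_of_frame[OF assms(1)]]],
        of "synthesis \<Phi> c"] by auto
  hence c: "c = analysis \<Phi> g"
    using inj by (simp add: inj_eq)
  have "complex_of_real ((norm c)\<^sup>2) = cinner (synthesis \<Phi> c) g"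
    unfolding cinner_synthesis[OF \<Phi>] c by (rule cinner_self[symmetric])
  from arg_cong[OF this, of cmod] have "(norm c)\<^sup>2 = cmod (cinner (synthesis \<Phi> c) g)"
    by (simp only: norm_of_real abs_power2)
  also have "\<dots> \<le> norm (synthesis \<Phi> c) * norm g"
    by (rule cauchy_schwarz)
  finally have "sqrt A * (norm c)\<^sup>2 \<le> sqrt A * (norm (synthesis \<Phi> c) * norm g)"
    using A by simp
  also have "\<dots> = norm (synthesis \<Phi> c) * (sqrt A * norm g)"
    by simp
  also have "\<dots> \<le> norm (synthesis \<Phi> c) * norm c"
    using norm_analysis_ge[OF assms(1), of g] by (intro mult_left_mono) (simp_all add: c)
  finally have "(sqrt A * norm c) * norm c \<le> norm (synthesis \<Phi> c) * norm c"
    by (simp add: power2_eq_square mult_ac)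
  thus ?thesis
    by (cases "c = 0") simp_all
qed

text \<open>
  If \<open>R\<close> inverts the synthesis operator, then \<open>\<parallel>f\<parallel>\<^sup>2 = \<langle>R f, analysis \<Phi> f\<rangle>\<close> bounds the analysis operator
  below. Hence the frame operator is invertible, and composing it with \<open>R\<close> leaves the analysis
  operator.
\<close>

lemma invertible_analysis:
  fixes \<Phi> :: "'i \<Rightarrow> 'h::chilbert_space"
  assumes \<Phi>: "bessel_sequence \<Phi> B" and inv: "invertible_operator (synthesis \<Phi>)"
  shows "invertible_operator (analysis \<Phi>)"
proof -
  have invs: "invertible_operator (inv (synthesis \<Phi>))"
    by (rule invertible_operator_inv[OF inv])
  have right: "synthesis \<Phi> (inv (synthesis \<Phi>) f) = f" for f
    using invertible_operator_bij[OF inv] by (simp add: bij_is_surj surj_f_inv_f)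
  have left: "inv (synthesis \<Phi>) (synthesis \<Phi> c) = c" for c
    using invertible_operator_bij[OF inv] by (simp add: bij_is_inj)
  obtain K where K: "0 < K" "\<And>f. norm (inv (synthesis \<Phi>) f) \<le> norm f * K"
    using invs bounded_linear.pos_bounded[of "inv (synthesis \<Phi>)"]
    by (auto simp: invertible_operator_def bounded_clinear_def)
  have "1 / K * norm f \<le> norm (analysis \<Phi> f)" for f
  proof -
    have "complex_of_real ((norm f)\<^sup>2) = cinner (inv (synthesis \<Phi>) f) (analysis \<Phi> f)"
      unfolding cinner_synthesis[OF \<Phi>, symmetric] right by (rule cinner_self[symmetric])
    from arg_cong[OF this, of cmod]
    have "(norm f)\<^sup>2 = cmod (cinner (inv (synthesis \<Phi>) f) (analysis \<Phi> f))"
      by (simp only: norm_of_real abs_power2)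
    also have "\<dots> \<le> norm (inv (synthesis \<Phi>) f) * norm (analysis \<Phi> f)"
      by (rule cauchy_schwarz)
    also have "\<dots> \<le> (norm f * K) * norm (analysis \<Phi> f)"
      by (intro mult_right_mono K(2)) simp
    finally have "norm f * norm f \<le> (K * norm (analysis \<Phi> f)) * norm f"
      by (simp add: power2_eq_square mult_ac)
    hence "norm f \<le> K * norm (analysis \<Phi> f)"
      using K(1) by (cases "f = 0") simp_all
    thus ?thesis
      using K(1) by (simp add: field_simps)
  qed
  hence "invertible_operator (synthesis \<Phi> \<circ> analysis \<Phi>)"
    using K(1) by (intro invertible_frame_operator[OF \<Phi>, of "1 / K"]) simp_all
  from invertible_operator_compose[OF invs this] show ?thesis
    by (simp add: o_def left)
qed

section \<open>Cross Gram matrices as operators\<close>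

lemma matrix_operator_cross_gram:
  fixes \<Phi> \<Psi> :: "'i \<Rightarrow> 'h::chilbert_space"
  assumes U: "bounded_clinear U" and \<Phi>: "bessel_sequence \<Phi> B" and \<Psi>: "bessel_sequence \<Psi> B'"
  shows "matrix_operator (cross_gram U \<Phi> \<Psi>) (analysis \<Phi> \<circ> U \<circ> synthesis \<Psi>)"
proof -
  have "((\<lambda>j. cross_gram U \<Phi> \<Psi> i j * ell2_nth c j) has_sum
          ell2_nth ((analysis \<Phi> \<circ> U \<circ> synthesis \<Psi>) c) i) UNIV" for c i
  proof -
    have "bounded_linear (\<lambda>x. cinner (U x) (\<Phi> i))"
      using U bounded_linear_cinner_left bounded_linear_compose
      by (fastforce simp: bounded_clinear_def)
    from has_sum_bounded_linear[OF this synthesis_has_sum[OF \<Psi>, of c]] show ?thesis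
      using U by (simp add: o_def ell2_nth_analysis[OF \<Phi>] cross_gram_def bounded_clinear_def
          cinner_scaleC_left mult.commute)
  qed
  thus ?thesis
    using U by (auto simp: matrix_operator_def intro!: bounded_clinear_compose
        bounded_clinear_analysis[OF \<Phi>] bounded_clinear_synthesis[OF \<Psi>])
qed

lemma matrix_operator_unique: "matrix_operator M S \<Longrightarrow> matrix_operator M T \<Longrightarrow> S = T"
  unfolding matrix_operator_def fun_eq_iff ell2_nth_inject[symmetric] by (blast intro: has_sum_unique)

lemma ell2_invertible_cross_gram:
  fixes \<Phi> \<Psi> :: "'i \<Rightarrow> 'h::chilbert_space"
  assumes "bessel_sequence \<Phi> B" "bessel_sequence \<Psi> B'"
    and "invertible_operator U" "invertible_operator (synthesis \<Phi>)" "invertible_operator (synthesis \<Psi>)"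
  shows "ell2_invertible (cross_gram U \<Phi> \<Psi>)"
  unfolding ell2_invertible_def
proof (intro exI conjI)
  show "matrix_operator (cross_gram U \<Phi> \<Psi>) (analysis \<Phi> \<circ> U \<circ> synthesis \<Psi>)"
    using assms by (intro matrix_operator_cross_gram) (auto simp: invertible_operator_def)
  show "invertible_operator (analysis \<Phi> \<circ> U \<circ> synthesis \<Psi>)"
    using assms by (intro invertible_operator_compose invertible_analysis)
qed

text \<open>
  A Gram operator that is invertible rules out redundancy of the frames. The factor applied first,
  \<open>synthesis \<Psi>\<close>, must be injective and is onto because \<open>\<Psi>\<close> is a frame; the factor applied last,
  \<open>analysis \<Phi>\<close>, must be onto and is injective because \<open>\<Phi>\<close> is a frame. So both can be cancelled, which
  leaves \<open>U\<close>.
\<close>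

lemma invertible_cross_gram_frames:
  fixes \<Phi> \<Psi> :: "'i \<Rightarrow> 'h::chilbert_space"
  assumes U: "bounded_clinear U" and \<Phi>: "frame \<Phi> A B" and \<Psi>: "frame \<Psi> A' B'"
    and G: "ell2_invertible (cross_gram U \<Phi> \<Psi>)"
  shows "invertible_operator (synthesis \<Phi>)" "invertible_operator (synthesis \<Psi>)"
    "invertible_operator U"
proof -
  have b: "bessel_sequence \<Phi> B" "bessel_sequence \<Psi> B'" and pos: "0 < A" "0 < A'"
    using \<Phi> \<Psi> by (auto simp: frame_def)
  define G where "G = analysis \<Phi> \<circ> U \<circ> synthesis \<Psi>"
  have Ginv: "invertible_operator G"
    using G matrix_operator_unique[OF matrix_operator_cross_gram[OF U b]]
    by (auto simp: ell2_invertible_def G_def)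
  hence Gbij: "inj G" "surj G"
    using invertible_operator_bij bij_is_inj bij_is_surj by blast+
  have inj\<Psi>: "inj (synthesis \<Psi>)"
    using Gbij(1) unfolding G_def by (rule inj_on_imageI2[of _ _ UNIV])
  show i\<Psi>: "invertible_operator (synthesis \<Psi>)"
    using inj\<Psi> surj_synthesis_frame[OF \<Psi>] pos norm_synthesis_ge[OF \<Psi> inj\<Psi>]
    by (intro invertible_operatorI_bij[of _ "sqrt A'"] bounded_clinear_synthesis[OF b(2)])
       (auto simp: bij_def)
  have "inj (analysis \<Phi>)"
  proof (rule injI)
    fix f g assume "analysis \<Phi> f = analysis \<Phi> g"
    hence "sqrt A * norm (f - g) \<le> 0"
      using norm_analysis_ge[OF \<Phi>, of "f - g"]
      by (simp add: bounded_clinear_diff[OF bounded_clinear_analysis[OF b(1)]])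
    thus "f = g"
      using pos by (simp add: mult_le_0_iff)
  qed
  moreover have "surj (analysis \<Phi>)"
    using Gbij(2) by (metis G_def comp_apply surj_def)
  ultimately have i\<Phi>: "invertible_operator (analysis \<Phi>)"
    using pos norm_analysis_ge[OF \<Phi>]
    by (intro invertible_operatorI_bij[of _ "sqrt A"] bounded_clinear_analysis[OF b(1)])
       (auto simp: bij_def)
  have *: "analysis \<Phi> (inv (analysis \<Phi>) c) = c" "inv (analysis \<Phi>) (analysis \<Phi> f) = f" for c f
    using invertible_operator_bij[OF i\<Phi>] by (simp_all add: bij_is_surj surj_f_inv_f bij_is_inj)
  have "synthesis \<Psi> (inv (synthesis \<Psi>) f) = f" for f
    using invertible_operator_bij[OF i\<Psi>] by (simp add: bij_is_surj surj_f_inv_f)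
  hence "inv (analysis \<Phi>) \<circ> G \<circ> inv (synthesis \<Psi>) = U"
    by (simp add: G_def fun_eq_iff *)
  thus "invertible_operator U"
    by (metis invertible_operator_compose invertible_operator_inv Ginv i\<Phi> i\<Psi>)
  \<comment> \<open>The frame operator of \<open>\<Phi>\<close> is invertible, so \<open>synthesis \<Phi>\<close> inherits invertibility from its adjoint.\<close>
  have "(synthesis \<Phi> \<circ> analysis \<Phi>) \<circ> inv (analysis \<Phi>) = synthesis \<Phi>"
    by (simp add: fun_eq_iff *)
  thus "invertible_operator (synthesis \<Phi>)"
    by (metis invertible_operator_compose invertible_operator_inv i\<Phi> invertible_frame_operator_of_frame[OF \<Phi>])
qed

section \<open>Orthonormal bases\<close>

text \<open>
  The countable index set is ordered by the enumeration \<open>to_nat\<close>, in which every element has only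
  finitely many predecessors. A vector that depends linearly on its predecessors gives the value 0.
\<close>

function gram_schmidt :: "('i::countable \<Rightarrow> 'h::complex_inner) \<Rightarrow> 'i \<Rightarrow> 'h" where
  "gram_schmidt X i = sgn (X i - (\<Sum>j | to_nat j < to_nat i.
     cinner (X i) (gram_schmidt X j) *\<^sub>C gram_schmidt X j))"
  by pat_completeness auto
termination
  by (relation "Wellfounded.measure (\<lambda>(X, i). to_nat i)") auto

declare gram_schmidt.simps [simp del]

lemma finite_to_nat_less: "finite {j :: 'i::countable. to_nat j < n}"
  using finite_vimageI[OF finite_lessThan inj_to_nat, of n] by (simp add: vimage_def)

text \<open>
  The span is part of the induction because it shows that \<open>X i\<close> differs from its projection onto the
  earlier vectors, so the normalisation does not divide by zero.
\<close>

lemma gram_schmidt_step: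
  fixes X :: "'i::countable \<Rightarrow> 'h::complex_inner"
  assumes ind: "\<And>i. X i \<notin> cspan (X ` {j. to_nat j < to_nat i})"
  shows "norm (gram_schmidt X i) = 1 \<and>
    (\<forall>j. to_nat j < to_nat i \<longrightarrow> cinner (gram_schmidt X i) (gram_schmidt X j) = 0) \<and>
    gram_schmidt X i \<in> cspan (X ` {j. to_nat j \<le> to_nat i})"
proof (induction i rule: measure_induct_rule[of to_nat])
  case (less i)
  define e where "e = gram_schmidt X"
  define p where "p = (\<Sum>j | to_nat j < to_nat i. cinner (X i) (e j) *\<^sub>C e j)"
  have e_i: "e i = inverse (norm (X i - p)) *\<^sub>R (X i - p)"
    by (simp add: e_def p_def gram_schmidt.simps[of X i] sgn_div_norm)
  have IH: "norm (e j) = 1" "e j \<in> cspan (X ` {k. to_nat k \<le> to_nat j})"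
    "\<And>k. to_nat k < to_nat j \<Longrightarrow> cinner (e j) (e k) = 0" if "to_nat j < to_nat i" for j
    using less[OF that] by (auto simp: e_def)
  have "e j \<in> cspan (X ` {k. to_nat k < to_nat i})" if "to_nat j < to_nat i" for j
    using IH(2)[OF that] that
      complex_vector.span_mono[OF image_mono[of "{k. to_nat k \<le> to_nat j}" "{k. to_nat k < to_nat i}" X]]
    by (auto simp: subset_iff)
  hence p: "p \<in> cspan (X ` {k. to_nat k < to_nat i})"
    unfolding p_def by (intro complex_vector.span_sum complex_vector.span_scale) simp
  hence ne: "X i - p \<noteq> 0"
    using ind[of i] by auto
  have "norm (e i) = 1"
    using ne by (simp add: e_i)
  moreover have "cinner (e i) (e j) = 0" if j: "to_nat j < to_nat i" for j
  proof -
    have "cinner (e k) (e j) = (if k = j then 1 else 0)" if k: "to_nat k < to_nat i" for k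
    proof -
      consider "k = j" | "to_nat k < to_nat j" | "to_nat j < to_nat k"
        by (metis linorder_neqE_nat to_nat_split from_nat_to_nat)
      thus ?thesis
        by cases (use IH[OF j] IH[OF k] cinner_commute[of "e k" "e j"] in \<open>auto simp: cinner_self\<close>)
    qed
    hence "cinner p (e j) = (\<Sum>k | to_nat k < to_nat i. if k = j then cinner (X i) (e j) else 0)"
      by (auto simp: p_def cinner_sum_left cinner_scaleC_left intro!: sum.cong)
    also have "\<dots> = cinner (X i) (e j)"
      using j by (simp add: finite_to_nat_less)
    finally show ?thesis
      by (simp add: e_i cinner_scaleR_left cinner_diff_left)
  qed
  moreover have "e i \<in> cspan (X ` {j. to_nat j \<le> to_nat i})"
  proof -
    have "p \<in> cspan (X ` {j. to_nat j \<le> to_nat i})"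
      using p complex_vector.span_mono[OF image_mono[of "{k. to_nat k < to_nat i}" "{k. to_nat k \<le> to_nat i}" X]]
      by (auto simp: subset_iff)
    thus ?thesis
      unfolding e_i scaleC_of_real[symmetric]
      by (intro complex_vector.span_scale complex_vector.span_diff[OF complex_vector.span_base]) auto
  qed
  ultimately show ?case
    by (simp add: e_def)
qed

lemma gram_schmidt_orthonormal:
  fixes X :: "'i::countable \<Rightarrow> 'h::complex_inner"
  assumes ind: "\<And>i. X i \<notin> cspan (X ` {j. to_nat j < to_nat i})"
  shows "cinner (gram_schmidt X i) (gram_schmidt X j) = (if i = j then 1 else 0)"
proof -
  note gs = gram_schmidt_step[of X, OF ind]
  consider "i = j" | "to_nat i < to_nat j" | "to_nat j < to_nat i"
    by (metis linorder_neqE_nat from_nat_to_nat)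
  thus ?thesis
    by cases (use gs[of i] gs[of j] cinner_commute[of "gram_schmidt X i" "gram_schmidt X j"]
        in \<open>auto simp: cinner_self\<close>)
qed

lemma in_cspan_gram_schmidt: "X i \<in> cspan (range (gram_schmidt X))"
proof -
  let ?e = "gram_schmidt X"
  define p where "p = (\<Sum>j | to_nat j < to_nat i. cinner (X i) (?e j) *\<^sub>C ?e j)"
  have "?e i = sgn (X i - p)"
    by (simp add: p_def gram_schmidt.simps[of X i])
  hence "X i = complex_of_real (norm (X i - p)) *\<^sub>C ?e i + p"
    by (cases "X i - p = 0") (simp_all add: scaleC_of_real sgn_div_norm)
  moreover have "complex_of_real (norm (X i - p)) *\<^sub>C ?e i + p \<in> cspan (range ?e)"
    unfolding p_def
    by (intro complex_vector.span_add complex_vector.span_scale complex_vector.span_sum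
        complex_vector.span_base) auto
  ultimately show ?thesis
    by simp
qed

text \<open>
  With \<open>p\<close> the projection of \<open>f\<close> onto the span of finitely many \<open>e\<^sub>i\<close> and \<open>s\<close> the corresponding partial
  sum, \<open>\<langle>f, p\<rangle> = \<parallel>p\<parallel>\<^sup>2 = s\<close> and therefore \<open>0 \<le> \<parallel>f - p\<parallel>\<^sup>2 = \<parallel>f\<parallel>\<^sup>2 - s\<close>.
\<close>

lemma bessel_inequality:
  fixes e :: "'i \<Rightarrow> 'h::complex_inner"
  assumes on: "\<And>i j. cinner (e i) (e j) = (if i = j then 1 else 0)"
  shows "bessel_sequence e 1"
proof -
  have L2: "L2_set (\<lambda>i. cmod (cinner f (e i))) F \<le> norm f" if "finite F" for f F
  proof -
    define p where "p = (\<Sum>i\<in>F. cinner f (e i) *\<^sub>C e i)"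
    define s where "s = (\<Sum>i\<in>F. (cmod (cinner f (e i)))\<^sup>2)"
    have s: "complex_of_real s = (\<Sum>i\<in>F. cinner f (e i) * cnj (cinner f (e i)))"
      by (simp only: s_def of_real_sum complex_norm_square)
    have pf: "cinner p f = complex_of_real s"
      unfolding s by (simp add: p_def cinner_sum_left cinner_scaleC_left flip: cinner_commute)
    have pe: "cinner p (e i) = cinner f (e i)" if "i \<in> F" for i
      using that \<open>finite F\<close> by (simp add: p_def cinner_sum_left cinner_scaleC_left on if_distrib cong: if_cong)
    have "cinner p p = (\<Sum>i\<in>F. cinner f (e i) * cnj (cinner p (e i)))"
      by (subst (1) p_def) (simp add: cinner_sum_left cinner_scaleC_left flip: cinner_commute)
    also have "\<dots> = complex_of_real s"
      by (simp add: s pe)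
    finally have "(norm p)\<^sup>2 = s"
      by (simp only: cinner_self of_real_eq_iff)
    moreover have "cinner f p = complex_of_real s"
      using cinner_commute[of f p] by (simp add: pf)
    ultimately have "s \<le> (norm f)\<^sup>2"
      using norm_diff_squared[of f p] zero_le_power2[of "norm (f - p)"] by simp
    thus ?thesis
      by (simp add: L2_set_def s_def real_le_lsqrt sum_nonneg)
  qed
  have "(\<Sum>\<^sub>\<infinity>i. (cmod (cinner f (e i)))\<^sup>2) \<le> (norm f)\<^sup>2" for f
    using square_summableI(2)[of "\<lambda>i. cinner f (e i)", OF L2]
    by (metis norm_ge_zero real_sqrt_abs real_sqrt_le_iff abs_of_nonneg)
  thus ?thesis
    using square_summableI(1)[OF L2] by (simp add: bessel_sequence_def)
qed

lemma ex_unit_ell2: "\<exists>c. ell2_nth c = (\<lambda>j. if j = i then 1 else 0)"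
proof -
  have "(\<lambda>j. (cmod (if j = i then 1 else 0))\<^sup>2) summable_on UNIV"
    by (rule has_sum_imp_summable[OF has_sum_finite_neutralI[of "{i}"]]) auto
  thus ?thesis
    using ell2_nth_cases by (metis mem_Collect_eq)
qed

lemma synthesis_unit:
  assumes "ell2_nth c = (\<lambda>j. if j = i then 1 else 0)"
  shows "synthesis X c = X i"
  unfolding synthesis_def assms
  by (rule infsumI, rule has_sum_finite_neutralI[of "{i}"]) auto

text \<open>
  Orthonormality gives the first identity coordinate by coordinate. For the second, the vectors fixed
  by \<open>synthesis e \<circ> analysis e\<close> form a closed subspace that contains the basis.
\<close>

lemma orthonormal_basis_analysis_inverse:
  fixes e :: "'i \<Rightarrow> 'h::chilbert_space"
  assumes "orthonormal_basis e"
  shows "analysis e (synthesis e c) = c" "synthesis e (analysis e f) = f"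
proof -
  have on: "cinner (e i) (e j) = (if i = j then 1 else 0)" for i j
    using assms by (simp add: orthonormal_basis_def)
  note B = bessel_inequality[of e, OF on]
  have "ell2_nth (analysis e (synthesis e c)) i = ell2_nth c i" for i
  proof (rule has_sum_unique)
    show "((\<lambda>j. cinner (ell2_nth c j *\<^sub>C e j) (e i)) has_sum ell2_nth (analysis e (synthesis e c)) i) UNIV"
      using has_sum_bounded_linear[OF bounded_linear_cinner_left synthesis_has_sum[OF B, of c], of "e i"]
      by (simp add: o_def ell2_nth_analysis[OF B])
    show "((\<lambda>j. cinner (ell2_nth c j *\<^sub>C e j) (e i)) has_sum ell2_nth c i) UNIV"
      by (rule has_sum_finite_neutralI[of "{i}"]) (auto simp: cinner_scaleC_left on)
  qed
  thus "analysis e (synthesis e c) = c"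
    by (simp add: ell2_nth_inject[symmetric] fun_eq_iff)
  define P where "P = synthesis e \<circ> analysis e"
  have P: "bounded_clinear P"
    unfolding P_def by (intro bounded_clinear_compose bounded_clinear_synthesis[OF B] bounded_clinear_analysis[OF B])
  have lin: "P (x + y) = P x + P y" "P 0 = 0" "P (a *\<^sub>C x) = a *\<^sub>C P x" for x y a
    using P by (auto simp: bounded_clinear_def linear_add linear_0 bounded_linear.linear)
  have "ell2_nth (analysis e (e i)) = (\<lambda>j. if j = i then 1 else 0)" for i
    by (auto simp: ell2_nth_analysis[OF B] on)
  hence "P (e i) = e i" for i
    by (simp add: P_def synthesis_unit)
  hence "cspan (range e) \<subseteq> {f. P f = f}"
    by (intro complex_vector.span_minimal) (auto simp: complex_vector.subspace_def lin)
  moreover have "closed {f. P f = f}"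
    by (intro closed_Collect_eq continuous_on_id bounded_linear.continuous_on[OF bounded_clinear_bounded_linear[OF P]])
  ultimately have "closure (cspan (range e)) \<subseteq> {f. P f = f}"
    by (rule closure_minimal)
  thus "synthesis e (analysis e f) = f"
    using assms by (auto simp: orthonormal_basis_def P_def)
qed

section \<open>Riesz bases\<close>

text \<open>
  Gram-Schmidt turns \<open>\<Xi>\<close> into an orthonormal basis \<open>e\<close> over the same index set, and
  \<open>synthesis \<Xi> \<circ> analysis e\<close> is a bijection that takes \<open>e\<^sub>i\<close> first to the \<open>i\<close>-th unit sequence and then
  to \<open>\<xi>\<^sub>i\<close>. Invertibility of the analysis operator supplies the linear independence, through biorthogonal
  vectors, and surjectivity of the synthesis operator supplies the density.
\<close>

lemma riesz_basisI:
  fixes \<Xi> :: "'i::countable \<Rightarrow> 'h::chilbert_space"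
  assumes \<Xi>: "bessel_sequence \<Xi> B" and inv: "invertible_operator (synthesis \<Xi>)"
  shows "riesz_basis \<Xi>"
proof -
  have bij: "bij (synthesis \<Xi>)"
    by (rule invertible_operator_bij[OF inv])
  have ind: "\<Xi> i \<notin> cspan (\<Xi> ` {j. to_nat j < to_nat i})" for i
  proof
    assume mem: "\<Xi> i \<in> cspan (\<Xi> ` {j. to_nat j < to_nat i})"
    obtain c where c: "ell2_nth c = (\<lambda>j. if j = i then 1 else 0)"
      using ex_unit_ell2[of i] by blast
    \<comment> \<open>\<open>g\<close> is biorthogonal to \<open>\<Xi>\<close>: it pairs to 1 with \<open>\<Xi> i\<close> and is orthogonal to every other member.\<close>
    obtain g where "analysis \<Xi> g = c"
      using surjD[OF bij_is_surj[OF invertible_operator_bij[OF invertible_analysis[OF \<Xi> inv]]], of c]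
      by auto
    hence g: "cinner g (\<Xi> j) = (if j = i then 1 else 0)" for j
      using c ell2_nth_analysis[OF \<Xi>, of g j] by simp
    have "cspan (\<Xi> ` {j. to_nat j < to_nat i}) \<subseteq> {x. cinner g x = 0}"
      by (intro complex_vector.span_minimal)
         (auto simp: complex_vector.subspace_def g cinner_add_right cinner_scaleC_right)
    thus False
      using mem g[of i] by auto
  qed
  define e where "e = gram_schmidt \<Xi>"
  have "f \<in> closure (cspan (range e))" for f
    unfolding closure_approachable
  proof (intro allI impI)
    fix r :: real assume "0 < r"
    obtain c where "f = synthesis \<Xi> c"
      using surjD[OF bij_is_surj[OF bij], of f] by auto
    hence "((\<lambda>i. ell2_nth c i *\<^sub>C \<Xi> i) has_sum f) UNIV"
      using synthesis_has_sum[OF \<Xi>, of c] by simp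
    then obtain F where "dist (\<Sum>i\<in>F. ell2_nth c i *\<^sub>C \<Xi> i) f \<le> r / 2"
      using has_sum_finite_approximation[of _ UNIV f "r / 2"] \<open>0 < r\<close> by fastforce
    moreover have "(\<Sum>i\<in>F. ell2_nth c i *\<^sub>C \<Xi> i) \<in> cspan (range e)"
      unfolding e_def
      by (intro complex_vector.span_sum complex_vector.span_scale in_cspan_gram_schmidt)
    ultimately show "\<exists>y\<in>cspan (range e). dist y f < r"
      using \<open>0 < r\<close> by (intro bexI[of _ "\<Sum>i\<in>F. ell2_nth c i *\<^sub>C \<Xi> i"]) auto
  qed
  hence e: "orthonormal_basis e"
    using gram_schmidt_orthonormal[of \<Xi>, OF ind] by (auto simp: orthonormal_basis_def e_def)
  have B: "bessel_sequence e 1"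
    using e by (intro bessel_inequality) (simp add: orthonormal_basis_def)
  define T where "T = synthesis \<Xi> \<circ> analysis e"
  have "bounded_clinear T"
    unfolding T_def
    by (intro bounded_clinear_compose bounded_clinear_synthesis[OF \<Xi>] bounded_clinear_analysis[OF B])
  moreover have "bij (analysis e)"
    by (rule o_bij[of "synthesis e"]) (simp_all add: fun_eq_iff orthonormal_basis_analysis_inverse[OF e])
  hence "bij T"
    unfolding T_def by (rule bij_comp[OF _ bij])
  moreover have "T (e i) = \<Xi> i" for i
  proof -
    have "ell2_nth (analysis e (e i)) = (\<lambda>j. if j = i then 1 else 0)"
      using e by (auto simp: ell2_nth_analysis[OF B] orthonormal_basis_def)
    thus ?thesis
      by (simp add: T_def synthesis_unit)
  qed
  ultimately show ?thesis
    using e unfolding riesz_basis_def by metis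
qed

section \<open>Perturbation of cross Gram matrices\<close>

text \<open>
  By the lower bound on an injective synthesis operator, a frame with invertible synthesis operator
  tolerates any perturbation of size less than \<open>sqrt A\<close>.
\<close>

lemma invertible_synthesis_perturbation:
  fixes \<Phi> \<Xi> :: "'i \<Rightarrow> 'h::chilbert_space"
  assumes \<Phi>: "frame \<Phi> A B" and inv: "invertible_operator (synthesis \<Phi>)"
    and \<Xi>: "bessel_sequence \<Xi> B'"
    and near: "\<And>c. norm (synthesis (\<lambda>i. \<Phi> i - \<Xi> i) c) \<le> b * norm c" and b: "0 \<le> b" "b < sqrt A"
  shows "invertible_operator (synthesis \<Xi>)"
proof (rule invertible_perturbation[OF inv bounded_clinear_synthesis[OF \<Xi>] _ _ b])
  show "sqrt A * norm c \<le> norm (synthesis \<Phi> c)" for c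
    using invertible_operator_bij[OF inv] by (intro norm_synthesis_ge[OF \<Phi>]) (rule bij_is_inj)
  show "norm (synthesis \<Phi> c - synthesis \<Xi> c) \<le> b * norm c" for c
    using near[of c] by (simp add: synthesis_diff[OF frame_bessel[OF \<Phi>] \<Xi>])
qed

theorem theorem6p5:
  fixes U V :: "'h::{chilbert_space, second_countable_topology} \<Rightarrow> 'h"
    and \<Phi> \<Psi> \<Xi> \<Theta> :: "'i::countable \<Rightarrow> 'h"
    and A\<^sub>\<Phi> A\<^sub>\<Psi> B\<^sub>\<Phi> B\<^sub>\<Psi> B\<^sub>\<Xi> B\<^sub>\<Theta> A B :: real
    and l\<^sub>1 l\<^sub>2 l\<^sub>3 l\<^sub>4 l \<mu> :: real
  assumes "bounded_clinear U" and "bounded_clinear V"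
    and "frame \<Phi> A\<^sub>\<Phi> B\<^sub>\<Phi>" and "frame \<Psi> A\<^sub>\<Psi> B\<^sub>\<Psi>"
    and "ell2_invertible (cross_gram U \<Phi> \<Psi>)"
    and "bessel_sequence \<Xi> B\<^sub>\<Xi>" and "bessel_sequence \<Theta> B\<^sub>\<Theta>"
    and "0 \<le> l\<^sub>1" and "0 \<le> l\<^sub>2" and "0 \<le> l\<^sub>3" and "0 \<le> l\<^sub>4"
    and "\<forall>c :: 'i ell2.
           norm (synthesis (\<lambda>i. \<Psi> i - \<Theta> i) c) + norm (synthesis (\<lambda>i. \<Phi> i - \<Xi> i) c)
             \<le> l\<^sub>1 * norm (synthesis \<Psi> c) + l\<^sub>2 * norm (synthesis \<Phi> c)
               + l\<^sub>3 * norm (synthesis \<Xi> c) + l\<^sub>4 * norm (synthesis \<Theta> c)"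
    and "B = Max {B\<^sub>\<Phi>, B\<^sub>\<Psi>, B\<^sub>\<Xi>, B\<^sub>\<Theta>}" and "A = min A\<^sub>\<Phi> A\<^sub>\<Psi>"
    and "l = l\<^sub>1 + l\<^sub>2 + l\<^sub>3 + l\<^sub>4"
    and "onorm (\<lambda>x. U x - V x) < \<mu>"
    and "\<mu> + 2 * onorm U * l < sqrt (A\<^sub>\<Psi> * A\<^sub>\<Phi>) / (onorm (inv U) * B)"
    and "l * (1 + 3 * sqrt (B / A)) < 1"
  shows "ell2_invertible (cross_gram V \<Xi> \<Theta>) \<and> riesz_basis \<Xi> \<and> riesz_basis \<Theta>"
proof -
  note U = assms(1) and V = assms(2) and \<Phi> = assms(3) and \<Psi> = assms(4) and \<Xi> = assms(6) and \<Theta> = assms(7)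
  note inv = invertible_cross_gram_frames[OF U \<Phi> \<Psi> assms(5)]
  have le: "B\<^sub>\<Phi> \<le> B" "B\<^sub>\<Psi> \<le> B" "B\<^sub>\<Xi> \<le> B" "B\<^sub>\<Theta> \<le> B"
    unfolding assms(13) by simp_all
  have bessel: "bessel_sequence \<Phi> B" "bessel_sequence \<Psi> B" "bessel_sequence \<Xi> B" "bessel_sequence \<Theta> B"
    using bessel_sequence_mono[OF frame_bessel[OF \<Phi>] le(1)]
      bessel_sequence_mono[OF frame_bessel[OF \<Psi>] le(2)]
      bessel_sequence_mono[OF \<Xi> le(3)] bessel_sequence_mono[OF \<Theta> le(4)] by simp_all
  have pos: "0 < A\<^sub>\<Phi>" "0 < A\<^sub>\<Psi>" "0 < A" "0 < B" and l: "0 \<le> l"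
    using \<Phi> \<Psi> bessel(1) assms by (simp_all add: frame_def bessel_sequence_def)
  \<comment> \<open>Every synthesis operator on the right of the hypothesis has norm at most \<open>sqrt B\<close>.\<close>
  have small: "norm (synthesis (\<lambda>i. \<Psi> i - \<Theta> i) c) + norm (synthesis (\<lambda>i. \<Phi> i - \<Xi> i) c)
      \<le> (l * sqrt B) * norm c" for c :: "'i ell2"
  proof -
    have "l\<^sub>1 * norm (synthesis \<Psi> c) + l\<^sub>2 * norm (synthesis \<Phi> c)
            + l\<^sub>3 * norm (synthesis \<Xi> c) + l\<^sub>4 * norm (synthesis \<Theta> c)
          \<le> l\<^sub>1 * (sqrt B * norm c) + l\<^sub>2 * (sqrt B * norm c)
            + l\<^sub>3 * (sqrt B * norm c) + l\<^sub>4 * (sqrt B * norm c)"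
      using assms(8-11) by (intro add_mono mult_left_mono norm_synthesis_le bessel)
    also have "\<dots> = (l * sqrt B) * norm c"
      by (simp add: assms(15) algebra_simps)
    finally show ?thesis
      using assms(12) order_trans by blast
  qed
  have "l * sqrt (B / A) \<le> l * (1 + 3 * sqrt (B / A))"
    using l pos by (intro mult_left_mono) simp_all
  hence "l * (sqrt B / sqrt A) < 1"
    using assms(18) by (simp add: real_sqrt_divide)
  hence "l * sqrt B < sqrt A"
    using pos by (simp add: field_simps)
  moreover have "sqrt A \<le> sqrt A\<^sub>\<Phi>" "sqrt A \<le> sqrt A\<^sub>\<Psi>"
    by (simp_all add: assms(14))
  ultimately have lt: "l * sqrt B < sqrt A\<^sub>\<Phi>" "l * sqrt B < sqrt A\<^sub>\<Psi>"
    by (blast intro: order_less_le_trans)+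
  have b0: "0 \<le> l * sqrt B"
    using l pos by simp
  have "norm (synthesis (\<lambda>i. \<Phi> i - \<Xi> i) c) \<le> (l * sqrt B) * norm c" for c :: "'i ell2"
    using small[of c] norm_ge_zero[of "synthesis (\<lambda>i. \<Psi> i - \<Theta> i) c"] by linarith
  hence inv\<Xi>: "invertible_operator (synthesis \<Xi>)"
    using lt b0 by (intro invertible_synthesis_perturbation[OF \<Phi> inv(1) \<Xi>])
  have "norm (synthesis (\<lambda>i. \<Psi> i - \<Theta> i) c) \<le> (l * sqrt B) * norm c" for c :: "'i ell2"
    using small[of c] norm_ge_zero[of "synthesis (\<lambda>i. \<Phi> i - \<Xi> i) c"] by linarith
  hence inv\<Theta>: "invertible_operator (synthesis \<Theta>)"
    using lt b0 by (intro invertible_synthesis_perturbation[OF \<Psi> inv(2) \<Theta>])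

  define N where "N = onorm (inv U)"
  have bl: "bounded_linear U" "bounded_linear (inv U)" "bounded_linear (\<lambda>x. U x - V x)"
    using U V invertible_operator_inv[OF inv(3)]
    by (auto simp: bounded_clinear_def invertible_operator_def intro: bounded_linear_sub)
  have "0 \<le> onorm (\<lambda>x. U x - V x)" "0 \<le> 2 * onorm U * l"
    using onorm_pos_le[OF bl(1)] onorm_pos_le[OF bl(3)] l by simp_all
  hence gap: "onorm (\<lambda>x. U x - V x) < sqrt (A\<^sub>\<Psi> * A\<^sub>\<Phi>) / (N * B)" "0 < sqrt (A\<^sub>\<Psi> * A\<^sub>\<Phi>) / (N * B)"
    using assms(16,17) unfolding N_def by linarith+
  hence N: "0 < N"
    using onorm_pos_le[OF bl(2)] by (cases "N = 0") (simp_all add: N_def)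
  \<comment> \<open>A nonzero vector is what makes lower frame bounds at most the upper ones; it exists because \<open>N\<close>
    cannot be 0: division by zero would make the right-hand side of the gap condition 0.\<close>
  have "\<exists>f :: 'h. f \<noteq> 0"
  proof (rule ccontr)
    assume "\<nexists>f :: 'h. f \<noteq> 0"
    hence "inv U = (\<lambda>x. 0)"
      by auto
    thus False
      using N by (simp add: N_def onorm_zero)
  qed
  then obtain f :: 'h where f: "f \<noteq> 0" ..
  have "A\<^sub>\<Psi> * A\<^sub>\<Phi> \<le> B * B"
    using frame_bounds_le[OF \<Phi> f] frame_bounds_le[OF \<Psi> f] le pos by (intro mult_mono) simp_all
  hence "sqrt (A\<^sub>\<Psi> * A\<^sub>\<Phi>) \<le> B"
    using pos by (intro real_le_lsqrt) (simp_all add: power2_eq_square)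
  hence "sqrt (A\<^sub>\<Psi> * A\<^sub>\<Phi>) / (N * B) \<le> 1 / N"
    using N pos by (simp add: field_simps)
  hence close: "onorm (\<lambda>x. U x - V x) < 1 / N"
    using gap by linarith
  have invV: "invertible_operator V"
  proof (rule invertible_perturbation[OF inv(3) V])
    show "1 / N * norm x \<le> norm (U x)" for x
      using onorm[OF bl(2), of "U x"] N invertible_operator_bij[OF inv(3)]
      by (simp add: N_def bij_is_inj field_simps)
    show "norm (U x - V x) \<le> onorm (\<lambda>x. U x - V x) * norm x" for x
      by (rule onorm[OF bl(3)])
  qed (use close onorm_pos_le[OF bl(3)] in auto)
  show ?thesis
    using ell2_invertible_cross_gram[OF \<Xi> \<Theta> invV inv\<Xi> inv\<Theta>] riesz_basisI[OF \<Xi> inv\<Xi>] riesz_basisI[OF \<Theta> inv\<Theta>]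
    by blast
qed

end
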